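(* Fix a rational number $e>1$. Over an unordered alphabet, there is an online algorithm with backtracking that detects $e$-repetitions and runs in $O(n\log m)$ total time and $O(m)$ space, where $n$ is the number of operations (reads and backtracks) in the given sequence and $m$ is the maximal length of the string $text$ over the whole execution of this sequence.
   Context: For a string $w$ and an integer $p\ge 1$, $p$ is a period of $w$ if $w=(uv)^ku$ for some integer $k\ge1$ and strings $u,v$ with $|uv|=p$. Given a rational $e>1$, a string $w$ is an $e$-repetition if $|w|\ge pe$ for some period $p$ of $w$. A string is $e$-repetition-free if none of its substrings (contiguous factors) is an $e$-repetition. The algorithm maintains a string $text$, which is initially empty, and processes a sequence of operations of two kinds. - A read operation appends a given letter to the right end of $text$. - A backtrack operation deletes the last letter of $text$. After each operation the algorithm must decide whether the current $text$ is $e$-repetition-free; this is what it means to detect $e$-repetitions online with backtracking. Unordered alphabet means that the only operation available on letters is testing two letters for equality in constant time; there is no order on letters. The constant $e$ is fixed, and constants hidden in the $O$-notation may depend on $e$. *)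

theory Defs
  imports Complex_Main "HOL-Library.Sublist"
begin

definition is_period :: "nat \<Rightarrow> 'a list \<Rightarrow> bool" where
  "is_period p w \<longleftrightarrow>
     p \<ge> 1 \<and> (\<exists>k u v. k \<ge> 1 \<and> length (u @ v) = p \<and> w = concat (replicate k (u @ v)) @ u)"

definition is_repetition :: "rat \<Rightarrow> 'a list \<Rightarrow> bool" where
  "is_repetition e w \<longleftrightarrow> (\<exists>p. is_period p w \<and> of_nat (length w) \<ge> of_nat p * e)"

definition repetition_free :: "rat \<Rightarrow> 'a list \<Rightarrow> bool" where
  "repetition_free e w \<longleftrightarrow> (\<forall>x. sublist x w \<longrightarrow> \<not> is_repetition e x)"

datatype 'a operation = Read 'a | Backtrack

fun update_text :: "'a operation \<Rightarrow> 'a list \<Rightarrow> 'a list" where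
  "update_text (Read a) w = w @ [a]"
| "update_text Backtrack w = butlast w"

definition text_after :: "'a operation list \<Rightarrow> 'a list" where
  "text_after ops = fold update_text ops []"

text \<open>There is no last letter to delete in the empty string.\<close>

definition valid_ops :: "'a operation list \<Rightarrow> bool" where
  "valid_ops ops \<longleftrightarrow>
     (\<forall>i < length ops. ops ! i = Backtrack \<longrightarrow> text_after (take i ops) \<noteq> [])"

definition max_length :: "'a operation list \<Rightarrow> nat" where
  "max_length ops = Max ((\<lambda>i. length (text_after (take i ops))) ` {..length ops})"

text \<open>
  The machine is a unit-cost RAM with structured control flow. Numbers and letters are kept
  apart: there are registers and a random access memory for numbers, and registers and a
  random access memory for letters (both memories addressed by numbers). A letter can only be
  copied between cells and compared for equality with another letter. In particular a program
  contains no letters, and the type of programs does not mention the alphabet.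
\<close>

datatype arith = Add | Sub | Mul | Div | Mod

fun arith_fun :: "arith \<Rightarrow> nat \<Rightarrow> nat \<Rightarrow> nat" where
  "arith_fun Add x y = x + y"
| "arith_fun Sub x y = x - y"
| "arith_fun Mul x y = x * y"
| "arith_fun Div x y = x div y"
| "arith_fun Mod x y = x mod y"

datatype test =
    Less nat nat
  | Equal nat nat
  | Same_Letter nat nat

datatype prog =
    Skip
  | Const nat nat
  | Arith arith nat nat nat
  | Load nat nat
  | Store nat nat
  | Load_Letter nat nat
  | Store_Letter nat nat
  | Seq prog prog
  | If test prog prog
  | While test prog

record 'a state =
  reg :: "nat \<Rightarrow> nat"
  mem :: "nat \<Rightarrow> nat"
  lreg :: "nat \<Rightarrow> 'a"
  lmem :: "nat \<Rightarrow> 'a"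

fun holds :: "test \<Rightarrow> 'a state \<Rightarrow> bool" where
  "holds (Less i j) s \<longleftrightarrow> reg s i < reg s j"
| "holds (Equal i j) s \<longleftrightarrow> reg s i = reg s j"
| "holds (Same_Letter i j) s \<longleftrightarrow> lreg s i = lreg s j"

text \<open>
  \<open>exec S W c s t s'\<close>: started in \<open>s\<close>, the program \<open>c\<close> stops in \<open>s'\<close> after \<open>t\<close> steps, and
  throughout the computation all memory addresses used are below \<open>S\<close> and all numbers produced
  are below \<open>W\<close>. A computation that would exceed one of the limits is stuck; the limits have no
  other influence (see \<open>exec_deterministic\<close>), so a program cannot obtain information from them.
  Running within \<open>S = O(m)\<close> and \<open>W = m^O(1)\<close> thus means using \<open>O(m)\<close> words of \<open>O(log m)\<close>
  bits; the bound on \<open>W\<close> rules out encoding long strings into single numbers, and bounding the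
  addresses rather than the number of touched cells rules out sparse use of zeroed memory.
\<close>

inductive exec :: "nat \<Rightarrow> nat \<Rightarrow> prog \<Rightarrow> 'a state \<Rightarrow> nat \<Rightarrow> 'a state \<Rightarrow> bool"
  for S W :: nat where
  Skip: "exec S W Skip s 1 s"
| Const: "n < W \<Longrightarrow> exec S W (Const r n) s 1 (s\<lparr>reg := (reg s)(r := n)\<rparr>)"
| Arith: "arith_fun f (reg s i) (reg s j) < W \<Longrightarrow>
    exec S W (Arith f r i j) s 1 (s\<lparr>reg := (reg s)(r := arith_fun f (reg s i) (reg s j))\<rparr>)"
| Load: "reg s i < S \<Longrightarrow>
    exec S W (Load r i) s 1 (s\<lparr>reg := (reg s)(r := mem s (reg s i))\<rparr>)"
| Store: "reg s i < S \<Longrightarrow>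
    exec S W (Store i r) s 1 (s\<lparr>mem := (mem s)(reg s i := reg s r)\<rparr>)"
| Load_Letter: "reg s i < S \<Longrightarrow>
    exec S W (Load_Letter r i) s 1 (s\<lparr>lreg := (lreg s)(r := lmem s (reg s i))\<rparr>)"
| Store_Letter: "reg s i < S \<Longrightarrow>
    exec S W (Store_Letter i r) s 1 (s\<lparr>lmem := (lmem s)(reg s i := lreg s r)\<rparr>)"
| Seq: "exec S W c1 s t1 s1 \<Longrightarrow> exec S W c2 s1 t2 s2 \<Longrightarrow>
    exec S W (Seq c1 c2) s (t1 + t2) s2"
| If_True: "holds b s \<Longrightarrow> exec S W c1 s t s1 \<Longrightarrow> exec S W (If b c1 c2) s (1 + t) s1"
| If_False: "\<not> holds b s \<Longrightarrow> exec S W c2 s t s1 \<Longrightarrow> exec S W (If b c1 c2) s (1 + t) s1"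
| While_False: "\<not> holds b s \<Longrightarrow> exec S W (While b c) s 1 s"
| While_True: "holds b s \<Longrightarrow> exec S W c s t1 s1 \<Longrightarrow> exec S W (While b c) s1 t2 s2 \<Longrightarrow>
    exec S W (While b c) s (1 + t1 + t2) s2"

inductive_cases exec_SkipE: "exec S W Skip s t s'"
inductive_cases exec_ConstE: "exec S W (Const r n) s t s'"
inductive_cases exec_ArithE: "exec S W (Arith f r i j) s t s'"
inductive_cases exec_LoadE: "exec S W (Load r i) s t s'"
inductive_cases exec_StoreE: "exec S W (Store i r) s t s'"
inductive_cases exec_Load_LetterE: "exec S W (Load_Letter r i) s t s'"
inductive_cases exec_Store_LetterE: "exec S W (Store_Letter i r) s t s'"
inductive_cases exec_SeqE: "exec S W (Seq c1 c2) s t s'"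
inductive_cases exec_IfE: "exec S W (If b c1 c2) s t s'"
inductive_cases exec_WhileE: "exec S W (While b c) s t s'"

lemma exec_deterministic:
  assumes "exec S W c s t s'" and "exec S' W' c s u s''"
  shows "t = u \<and> s' = s''"
  using assms
proof (induction arbitrary: u s'' rule: exec.induct)
  case (Skip s)
  then show ?case by (auto elim: exec_SkipE)
next
  case (Const n r s)
  then show ?case by (auto elim: exec_ConstE)
next
  case (Arith f s i j r)
  then show ?case by (auto elim: exec_ArithE)
next
  case (Load s i r)
  from Load.prems show ?case by (rule exec_LoadE) simp
next
  case (Store s i r)
  from Store.prems show ?case by (rule exec_StoreE) simp
next
  case (Load_Letter s i r)
  from Load_Letter.prems show ?case by (rule exec_Load_LetterE) simp
next
  case (Store_Letter s i r)
  from Store_Letter.prems show ?case by (rule exec_Store_LetterE) simp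
next
  case (Seq c1 s t1 s1 c2 t2 s2)
  from Seq.prems obtain u1 u2 r1
    where "u = u1 + u2" "exec S' W' c1 s u1 r1" "exec S' W' c2 r1 u2 s''"
    by (rule exec_SeqE)
  with Seq.IH show ?case by metis
next
  case (If_True b s c1 t s1 c2)
  from If_True.prems If_True.hyps(1) obtain u1 where "u = 1 + u1" "exec S' W' c1 s u1 s''"
    by (auto elim: exec_IfE)
  with If_True.IH show ?case by metis
next
  case (If_False b s c2 t s1 c1)
  from If_False.prems If_False.hyps(1) obtain u1 where "u = 1 + u1" "exec S' W' c2 s u1 s''"
    by (auto elim: exec_IfE)
  with If_False.IH show ?case by metis
next
  case (While_False b s c)
  from While_False.prems While_False.hyps show ?case by (auto elim: exec_WhileE)
next
  case (While_True b s c t1 s1 t2 s2)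
  from While_True.prems While_True.hyps(1) obtain u1 u2 r1
    where "u = 1 + u1 + u2" "exec S' W' c s u1 r1" "exec S' W' (While b c) r1 u2 s''"
    by (auto elim: exec_WhileE)
  with While_True.IH show ?case by metis
qed

text \<open>
  An algorithm is a pair of programs. The first one is executed at each read operation, with the
  letter read placed in letter register 0; the second one is executed at each backtrack operation.
  All registers and memories persist between operations. When a program stops, its answer for the
  current text is ``yes'' iff register 0 is nonzero. Hence each answer is given before the next
  operation is known.
\<close>

fun handler :: "prog \<times> prog \<Rightarrow> 'a operation \<Rightarrow> prog" where
  "handler alg (Read a) = fst alg"
| "handler alg Backtrack = snd alg"

fun feed :: "'a operation \<Rightarrow> 'a state \<Rightarrow> 'a state" where
  "feed (Read a) s = s\<lparr>lreg := (lreg s)(0 := a)\<rparr>"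
| "feed Backtrack s = s"

text \<open>
  \<open>run S W alg s ops answers t s'\<close>: processing \<open>ops\<close> one after another from \<open>s\<close>, the algorithm
  gives the listed answers, one per operation, and ends in \<open>s'\<close> after \<open>t\<close> steps in total.
\<close>

inductive run :: "nat \<Rightarrow> nat \<Rightarrow> prog \<times> prog \<Rightarrow> 'a state \<Rightarrow> 'a operation list
    \<Rightarrow> bool list \<Rightarrow> nat \<Rightarrow> 'a state \<Rightarrow> bool"
  for S W :: nat and alg :: "prog \<times> prog" where
  Nil: "run S W alg s [] [] 0 s"
| Cons: "exec S W (handler alg op) (feed op s) t1 s1 \<Longrightarrow> run S W alg s1 ops answers t2 s2 \<Longrightarrow>
    run S W alg s (op # ops) ((reg s1 0 \<noteq> 0) # answers) (t1 + t2) s2"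

text \<open>
  Number cells initially contain 0. As no letter is distinguished, letter cells initially contain
  unspecified letters \<open>L\<close> and \<open>A\<close>.
\<close>

definition initial_state :: "(nat \<Rightarrow> 'a) \<Rightarrow> (nat \<Rightarrow> 'a) \<Rightarrow> 'a state" where
  "initial_state L A = \<lparr>reg = (\<lambda>_. 0), mem = (\<lambda>_. 0), lreg = L, lmem = A\<rparr>"

definition detects_repetitions :: "rat \<Rightarrow> 'a operation list \<Rightarrow> bool list \<Rightarrow> bool" where
  "detects_repetitions e ops answers \<longleftrightarrow>
     length answers = length ops \<and>
     (\<forall>i < length ops. answers ! i \<longleftrightarrow> repetition_free e (text_after (take (Suc i) ops)))"

end

theory Submission
  imports Defs
begin

text \<open>
  Write \<open>e = 1 + a / b\<close>. A repetition of period \<open>p\<close> at the end of the text is a match of the text with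
  itself at distance \<open>p\<close> on its last \<open>l \<ge> a * p / b\<close> positions. The periods are divided into
  \<open>O(log m)\<close> items, intervals of length \<open>s = 2 ^ k\<close> whose periods are of order \<open>s\<close>. Each item keeps an
  anchor \<open>E\<close> in the text, at most \<open>2 * s\<close> positions before its end, so that a repetition whose period
  belongs to the item contains a long match ending at \<open>E\<close>. As the text before \<open>E\<close> is repetition-free,
  at most one period of the item has such a match, and a match of length \<open>l\<close> at distance \<open>p\<close> excludes
  the periods up to \<open>p + l / a\<close>; skipping these, naive comparison finds the period in time \<open>O(s)\<close>, with
  no pattern matching automaton. Afterwards one comparison per letter tells how far this match extends.
  The anchor moves by \<open>s\<close> when the length of the text leaves the interval from \<open>E\<close> to \<open>E + 2 * s\<close>, and
  then the length is within \<open>1\<close> of \<open>E + s\<close> for the new anchor. Hence \<open>s\<close> operations pass before the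
  next move, in spite of backtracking, and the amortized cost is constant per item and operation.
\<close>

section \<open>Weakest preconditions with running time\<close>

text \<open>The tiling has \<open>3 * b\<close> intervals per size because a period
  \<open>p \<ge> 3 * b * s\<close> forces \<open>l \<ge> 3 * a * s\<close>: at most
  \<open>2 * s - 1\<close> of these positions lie after \<open>E\<close>, and at least
  \<open>a * (s - 1)\<close> remain before it. This length makes the period unique, as two periods
  of one item differ by at most \<open>s - 1\<close>. A repetition before \<open>E\<close> would
  destroy both this uniqueness and the time bound of the scan. Hence the items rest from the moment
  a repetition appears until the shortest prefix containing one loses its last letter. What they see
  is still a sequence of lengths in which neighbours differ by one, and the shorter of two
  neighbouring texts is always repetition-free. Reads and backtracks may alternate arbitrarily, so
  moves of an anchor are paid by a potential, the distance of the length from \<open>E + s\<close>.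
  With this potential alone every item would start with debt \<open>s\<close>; the anchor 0, which
  cannot move left, is therefore exempt below \<open>s\<close>. Items larger than the text keep the
  anchor 0, so that zeroed memory represents all of them and only \<open>O(log m)\<close> items are
  visited.\<close>

definition wp :: "nat \<Rightarrow> nat \<Rightarrow> prog \<Rightarrow> (nat \<Rightarrow> 'a state \<Rightarrow> bool) \<Rightarrow> 'a state \<Rightarrow> bool" where
  "wp S W c Q s \<longleftrightarrow> (\<exists>t s'. exec S W c s t s' \<and> Q t s')"

lemma wp_mono: "wp S W c Q s \<Longrightarrow> (\<And>t s'. Q t s' \<Longrightarrow> R t s') \<Longrightarrow> wp S W c R s"
  unfolding wp_def by blast

lemma wp_Skip [simp]:
  "wp S W Skip Q s \<longleftrightarrow> Q 1 s"
  unfolding wp_def by (metis exec.Skip exec_SkipE)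

lemma wp_Const [simp]:
  "wp S W (Const r n) Q s \<longleftrightarrow> n < W \<and> Q 1 (s\<lparr>reg := (reg s)(r := n)\<rparr>)"
  unfolding wp_def by (metis exec.Const exec_ConstE)

lemma wp_Arith [simp]:
  "wp S W (Arith f r i j) Q s \<longleftrightarrow> arith_fun f (reg s i) (reg s j) < W \<and>
     Q 1 (s\<lparr>reg := (reg s)(r := arith_fun f (reg s i) (reg s j))\<rparr>)"
  unfolding wp_def by (metis exec.Arith exec_ArithE)

lemma wp_Load [simp]:
  "wp S W (Load r i) Q s \<longleftrightarrow> reg s i < S \<and> Q 1 (s\<lparr>reg := (reg s)(r := mem s (reg s i))\<rparr>)"
  unfolding wp_def by (metis exec.Load exec_LoadE)

lemma wp_Store [simp]:
  "wp S W (Store i r) Q s \<longleftrightarrow> reg s i < S \<and> Q 1 (s\<lparr>mem := (mem s)(reg s i := reg s r)\<rparr>)"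
  unfolding wp_def by (metis exec.Store exec_StoreE)

lemma wp_Load_Letter [simp]:
  "wp S W (Load_Letter r i) Q s \<longleftrightarrow> reg s i < S \<and> Q 1 (s\<lparr>lreg := (lreg s)(r := lmem s (reg s i))\<rparr>)"
  unfolding wp_def by (metis exec.Load_Letter exec_Load_LetterE)

lemma wp_Store_Letter [simp]:
  "wp S W (Store_Letter i r) Q s \<longleftrightarrow> reg s i < S \<and> Q 1 (s\<lparr>lmem := (lmem s)(reg s i := lreg s r)\<rparr>)"
  unfolding wp_def by (metis exec.Store_Letter exec_Store_LetterE)

lemma wp_Seq [simp]:
  "wp S W (Seq c1 c2) Q s \<longleftrightarrow> wp S W c1 (\<lambda>t1 s1. wp S W c2 (\<lambda>t2 s2. Q (t1 + t2) s2) s1) s"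
  unfolding wp_def by (metis exec.Seq exec_SeqE)

text \<open>While \<open>wp_Seq\<close> serves to execute straight-line code symbolically, this rule
  cuts at an assertion \<open>R\<close>; it is used where the first program contains a loop or has a
  specification of its own.\<close>

lemma wp_SeqI:
  assumes "wp S W c1 R s" "\<And>t1 s1. R t1 s1 \<Longrightarrow> wp S W c2 (\<lambda>t2. Q (t1 + t2)) s1"
  shows "wp S W (Seq c1 c2) Q s"
  using assms by (auto elim: wp_mono)

lemma wp_If [simp]:
  "wp S W (If b c1 c2) Q s \<longleftrightarrow>
     (if holds b s then wp S W c1 (\<lambda>t. Q (1 + t)) s else wp S W c2 (\<lambda>t. Q (1 + t)) s)"
  unfolding wp_def by (cases "holds b s") (auto 0 4 elim!: exec_IfE
      intro: exec.If_True[unfolded plus_1_eq_Suc] exec.If_False[unfolded plus_1_eq_Suc])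

text \<open>\<open>V\<close> is at once the termination measure and the time that is still available.\<close>

lemma wp_While:
  assumes "I s"
    and step: "\<And>s. I s \<Longrightarrow> holds b s \<Longrightarrow> wp S W c (\<lambda>t s'. I s' \<and> t + 1 + V s' \<le> V s) s"
    and post: "\<And>t s'. I s' \<Longrightarrow> \<not> holds b s' \<Longrightarrow> t + V s' \<le> V s + 1 \<Longrightarrow> Q t s'"
  shows "wp S W (While b c) Q s"
proof -
  have "wp S W (While b c) (\<lambda>t s'. I s' \<and> \<not> holds b s' \<and> t + V s' \<le> V s + 1) s"
    using \<open>I s\<close>
  proof (induction "V s" arbitrary: s rule: less_induct)
    case less
    show ?case
    proof (cases "holds b s")
      case True
      from step[OF less.prems True] obtain t1 s1
        where 1: "exec S W c s t1 s1" "I s1" "t1 + 1 + V s1 \<le> V s"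
        unfolding wp_def by blast
      with less.hyps[of s1] obtain t2 s2
        where "exec S W (While b c) s1 t2 s2" "I s2" "\<not> holds b s2" "t2 + V s2 \<le> V s1 + 1"
        unfolding wp_def by auto
      with 1 True exec.While_True[of b s S W c t1 s1 t2 s2] show ?thesis
        unfolding wp_def by (intro exI[of _ "1 + t1 + t2"] exI[of _ s2]) auto
    next
      case False
      with less.prems exec.While_False[of b s S W c] show ?thesis
        unfolding wp_def by (intro exI[of _ 1] exI[of _ s]) auto
    qed
  qed
  then show ?thesis
    by (rule wp_mono) (use post in blast)
qed

fun block :: "prog list \<Rightarrow> prog" where
  "block [] = Skip"
| "block (c # cs) = Seq c (block cs)"

section \<open>Matches and repetitions\<close>

definition matching :: "(nat \<Rightarrow> 'a) \<Rightarrow> nat \<Rightarrow> nat \<Rightarrow> nat \<Rightarrow> bool" where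
  "matching f p x y \<longleftrightarrow> (\<forall>z. x \<le> z \<longrightarrow> z < y \<longrightarrow> f z = f (z - p))"

text \<open>A repetition is represented by the interval that equals its copy \<open>p\<close>
  positions to the left; the repetition itself starts at \<open>x - p\<close>. Thus
  \<open>p \<le> x\<close> keeps it inside the text and the truncated subtraction in
  \<open>matching\<close> harmless, and the length test is \<open>|w| \<ge> p * e\<close> after
  subtracting \<open>p\<close> from both sides.\<close>

definition free_upto :: "nat \<Rightarrow> nat \<Rightarrow> (nat \<Rightarrow> 'a) \<Rightarrow> nat \<Rightarrow> bool" where
  "free_upto a b f n \<longleftrightarrow>
     \<not> (\<exists>p x y. 1 \<le> p \<and> p \<le> x \<and> x \<le> y \<and> y \<le> n \<and> matching f p x y \<and> a * p \<le> b * (y - x))"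

lemma matching_cong: "(\<And>z. z < y \<Longrightarrow> f z = g z) \<Longrightarrow> matching f p x y = matching g p x y"
  unfolding matching_def by (metis less_imp_diff_less)

lemma matching_empty [simp]: "y \<le> x \<Longrightarrow> matching f p x y"
  unfolding matching_def by auto

lemma matching_subset: "matching f p x y \<Longrightarrow> x \<le> x' \<Longrightarrow> y' \<le> y \<Longrightarrow> matching f p x' y'"
  unfolding matching_def by auto

lemma matching_join: "matching f p x y \<Longrightarrow> matching f p y z \<Longrightarrow> matching f p x z"
  unfolding matching_def by (meson not_le_imp_less)

lemma free_upto_cong:
  assumes "\<And>z. z < n \<Longrightarrow> f z = g z"
  shows "free_upto a b f n = free_upto a b g n"
proof -
  have "matching f p x y = matching g p x y" if "y \<le> n" for p x y
    by (rule matching_cong) (use assms that in auto)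
  then show ?thesis
    unfolding free_upto_def by blast
qed

lemma free_upto_mono: "free_upto a b f n \<Longrightarrow> m \<le> n \<Longrightarrow> free_upto a b f m"
  unfolding free_upto_def by (meson le_trans)

lemma free_upto_length:
  assumes "free_upto a b f n" "1 \<le> p" "p \<le> x" "x \<le> y" "y \<le> n" "matching f p x y"
  shows "b * (y - x) < a * p"
  using assms unfolding free_upto_def by (meson not_le_imp_less)

text \<open>Two matches at distances \<open>p < p'\<close> ending at the same place give a match at distance
  \<open>p' - p\<close>; in a repetition-free text it cannot be long compared with \<open>p' - p\<close>.\<close>

lemma matching_conflict:
  assumes free: "free_upto a b f E" and b: "1 \<le> b"
    and "p < p'" "p' + l \<le> E" "matching f p (E - l) E" "matching f p' (E - l) E"
    and long: "a * (p' - p) \<le> l"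
  shows False
proof -
  have "matching f (p' - p) (E - l - p) (E - p)"
    unfolding matching_def
  proof (intro allI impI)
    fix z assume z: "E - l - p \<le> z" "z < E - p"
    have "f (z + p) = f (z + p - p)" "f (z + p) = f (z + p - p')"
      using assms(5,6)[unfolded matching_def, rule_format, of "z + p"] z by linarith+
    moreover have "z + p - p' = z - (p' - p)"
      using assms(3) by linarith
    ultimately show "f z = f (z - (p' - p))"
      by (metis add_diff_cancel_right')
  qed
  moreover have "a * (p' - p) \<le> b * (E - p - (E - l - p))"
  proof -
    have "E - p - (E - l - p) = l"
      using assms(3,4) by simp
    moreover have "1 * l \<le> b * l"
      using b by (rule mult_le_mono1)
    ultimately show ?thesis
      using long by (metis le_trans mult_1)
  qed
  ultimately show False
    using free_upto_length[OF free, of "p' - p" "E - l - p" "E - p"] assms(3,4) by linarith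
qed

section \<open>Periods of strings as matches\<close>

text \<open>Forwards, \<open>w = (uv)^k u\<close> satisfies
  \<open>(u @ v) @ w = w @ (v @ u)\<close>, and comparing the letters at one position of both sides
  gives the match. Backwards, the first \<open>p\<close> letters are removed by induction on the
  length; the match says that they reappear at the front of the rest, or that the rest is a prefix
  of them.\<close>

lemma is_period_iff:
  "is_period p w \<longleftrightarrow> 1 \<le> p \<and> p \<le> length w \<and> matching (\<lambda>x. w ! x) p p (length w)"
proof
  assume "is_period p w"
  then obtain k u v where *: "p \<ge> 1" "k \<ge> 1" "length (u @ v) = p"
      "w = concat (replicate k (u @ v)) @ u"
    unfolding is_period_def by blast
  have "length (concat (replicate k (u @ v))) = k * p"
    using *(3) by (simp add: length_concat sum_list_replicate)
  moreover have "p \<le> k * p"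
    using *(2) by simp
  ultimately have le: "p \<le> length w"
    unfolding *(4) length_append by linarith
  have "concat (replicate k (u @ v)) @ (u @ v) = (u @ v) @ concat (replicate k (u @ v))" for k
    by (induction k) auto
  then have eq: "(u @ v) @ w = w @ (v @ u)"
    unfolding *(4) by (metis append.assoc)
  have "w ! z = w ! (z - p)" if "p \<le> z" "z < length w" for z
  proof -
    have "w ! z = ((u @ v) @ w) ! z"
      unfolding eq using that by (simp add: nth_append)
    then show ?thesis
      using that *(3) by (simp only: nth_append) simp
  qed
  with le *(1) show "1 \<le> p \<and> p \<le> length w \<and> matching (\<lambda>x. w ! x) p p (length w)"
    unfolding matching_def by auto
next
  assume "1 \<le> p \<and> p \<le> length w \<and> matching (\<lambda>x. w ! x) p p (length w)"
  then have p: "1 \<le> p" and "p \<le> length w" and "\<And>z. p \<le> z \<Longrightarrow> z < length w \<Longrightarrow> w ! z = w ! (z - p)"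
    unfolding matching_def by auto
  then have "\<exists>k u v. k \<ge> 1 \<and> length (u @ v) = p \<and> w = concat (replicate k (u @ v)) @ u"
  proof (induction "length w" arbitrary: w rule: less_induct)
    case less
    let ?y = "take p w" and ?w = "drop p w"
    have nth: "?w ! z = w ! z" if "z < length w - p" for z
      using less.prems(2) less.prems(3)[of "p + z"] that by simp
    show ?case
    proof (cases "length ?w < p")
      case True
      have "?w = take (length ?w) ?y"
        by (rule nth_equalityI) (use True less.prems(2) nth in auto)
      then obtain v where v: "?y = ?w @ v"
        by (metis append_take_drop_id)
      have "w = ?y @ ?w"
        by simp
      then have "w = concat (replicate 1 (?w @ v)) @ ?w"
        using v by simp
      moreover have "length (?w @ v) = p"
        using less.prems(2) v[symmetric] by simp
      ultimately show ?thesis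
        by (meson le_refl)
    next
      case False
      have "?w ! z = ?w ! (z - p)" if "p \<le> z" "z < length ?w" for z
        using nth[of z] that less.prems(2) by (simp add: add.commute)
      moreover have "length ?w < length w" "p \<le> length ?w"
        using less.prems(2) p False by auto
      ultimately obtain k u v
        where k: "k \<ge> 1" "length (u @ v) = p" "?w = concat (replicate k (u @ v)) @ u"
        using less.hyps[of ?w] p by blast
      have "?y = take p ?w"
        by (rule nth_equalityI) (use False less.prems(2) nth in auto)
      also have "\<dots> = u @ v"
      proof -
        from k(1) obtain k' where "k = Suc k'"
          using not0_implies_Suc by fastforce
        then have "?w = (u @ v) @ (concat (replicate k' (u @ v)) @ u)"
          using k(3) by simp
        then show ?thesis
          using k(2) by (metis append_eq_conv_conj)
      qed
      finally have "w = concat (replicate (Suc k) (u @ v)) @ u"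
        using k(3) by (metis append.assoc append_take_drop_id concat.simps(2) replicate_Suc)
      with k(2) show ?thesis
        by (intro exI[of _ "Suc k"] exI[of _ u] exI[of _ v]) auto
    qed
  qed
  with p show "is_period p w"
    unfolding is_period_def by blast
qed

lemma repetition_free_iff:
  fixes a b :: nat
  assumes "1 \<le> a" "1 \<le> b" and e: "e = 1 + of_nat a / of_nat b"
  shows "repetition_free e w \<longleftrightarrow> free_upto a b (\<lambda>x. w ! x) (length w)"
proof -
  have long: "of_nat n \<ge> of_nat p * e \<longleftrightarrow> a * p \<le> b * (n - p)" if "p \<le> n" for n p
  proof -
    have "of_nat n \<ge> of_nat p * e \<longleftrightarrow> (of_nat (a * p) :: rat) \<le> of_nat (b * (n - p))"
      unfolding e using assms(2) that by (simp add: field_simps of_nat_diff)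
    then show ?thesis
      using of_nat_le_iff by blast
  qed
  have shift: "matching (\<lambda>x. (us @ v @ ws) ! x) p (length us + p) (length us + length v) \<longleftrightarrow>
      matching (\<lambda>x. v ! x) p p (length v)" for us v ws :: "'a list" and p
  proof
    assume L: "matching (\<lambda>x. (us @ v @ ws) ! x) p (length us + p) (length us + length v)"
    show "matching (\<lambda>x. v ! x) p p (length v)"
      unfolding matching_def
    proof (intro allI impI)
      fix z assume "p \<le> z" "z < length v"
      moreover from this have "length us + z - p = length us + (z - p)" "z - p < length v"
        by auto
      ultimately show "v ! z = v ! (z - p)"
        using L[unfolded matching_def, rule_format, of "length us + z"]
        by (auto simp: nth_append)
    qed
  next
    assume R: "matching (\<lambda>x. v ! x) p p (length v)"
    show "matching (\<lambda>x. (us @ v @ ws) ! x) p (length us + p) (length us + length v)"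
      unfolding matching_def
    proof (intro allI impI)
      fix z assume z: "length us + p \<le> z" "z < length us + length v"
      then have "z - length us - p = z - p - length us" by simp
      with R[unfolded matching_def, rule_format, of "z - length us"] z
      show "(us @ v @ ws) ! z = (us @ v @ ws) ! (z - p)"
        by (auto simp: nth_append diff_commute)
    qed
  qed
  show ?thesis
  proof (rule iffI; rule ccontr)
    assume free: "repetition_free e w" and "\<not> free_upto a b (\<lambda>x. w ! x) (length w)"
    then obtain p x y where *: "1 \<le> p" "p \<le> x" "x \<le> y" "y \<le> length w"
        "matching (\<lambda>x. w ! x) p x y" "a * p \<le> b * (y - x)"
      unfolding free_upto_def by blast
    define us v ws where "us = take (x - p) w" and "v = drop (x - p) (take y w)" and "ws = drop y w"
    have "take (x - p) (take y w) = us"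
      using * by (simp add: us_def min_def)
    then have w: "w = us @ v @ ws"
      unfolding v_def ws_def by (metis append.assoc append_take_drop_id)
    have len: "length us = x - p" "length v = y - (x - p)"
      using * by (auto simp: us_def v_def)
    have "is_period p v"
      unfolding is_period_iff using *(1-5) len shift[of us v ws p] w by simp
    moreover have "of_nat (length v) \<ge> of_nat p * e"
      using long[of p "length v"] * len by simp
    moreover have "sublist v w"
      unfolding w by (auto simp: sublist_def)
    ultimately show False
      using free unfolding repetition_free_def is_repetition_def by blast
  next
    assume free: "free_upto a b (\<lambda>x. w ! x) (length w)" and "\<not> repetition_free e w"
    then obtain us v ws p where w: "w = us @ v @ ws" and p: "is_period p v"
        "of_nat (length v) \<ge> of_nat p * e"
      unfolding repetition_free_def is_repetition_def sublist_def by blast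
    from p(1) have *: "1 \<le> p" "p \<le> length v" "matching (\<lambda>x. v ! x) p p (length v)"
      unfolding is_period_iff by auto
    with shift[of us v ws p] w
    have "matching (\<lambda>x. w ! x) p (length us + p) (length us + length v)" by simp
    from free_upto_length[OF free *(1) _ _ _ this] * w
    have "b * (length v - p) < a * p" by simp
    with long[of p "length v"] * p(2) show False by simp
  qed
qed

section \<open>Items\<close>

text \<open>Item \<open>q\<close> is responsible for the periods \<open>p\<close> with \<open>low K q \<le> p < low K q + size_of K q\<close>. These
  intervals tile the positive integers; the sizes are the powers of two, each power \<open>s > 1\<close> being
  used for the \<open>K\<close> intervals between \<open>K * s\<close> and \<open>2 * K * s\<close>.\<close>

fun item :: "nat \<Rightarrow> nat \<Rightarrow> nat \<times> nat" where
  "item K 0 = (1, 1)"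
| "item K (Suc q) = (case item K q of (s, lo) \<Rightarrow>
     (if lo + s = 2 * K * s then 2 * s else s, lo + s))"

abbreviation size_of :: "nat \<Rightarrow> nat \<Rightarrow> nat" where
  "size_of K q \<equiv> fst (item K q)"

abbreviation low :: "nat \<Rightarrow> nat \<Rightarrow> nat" where
  "low K q \<equiv> snd (item K q)"

lemma item_Suc:
  "low K (Suc q) = low K q + size_of K q"
  "size_of K (Suc q) =
     (if low K q + size_of K q = 2 * K * size_of K q then 2 * size_of K q else size_of K q)"
  by (simp_all split: prod.split)

declare item.simps(2) [simp del]

text \<open>Here \<open>k\<close> counts the doublings and \<open>c\<close> is the lowest period in
  units of the size. When \<open>c + 1\<close> reaches \<open>2 * K\<close>, the lowest period is
  \<open>K\<close> units of the doubled size, so \<open>c\<close> restarts at \<open>K\<close>.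
  Level 0 alone starts at \<open>c = 1\<close>, which is why \<open>q + 1\<close> and not
  \<open>q\<close> has the form \<open>k * K + c\<close>.\<close>

lemma item_form:
  assumes "2 \<le> K"
  shows "\<exists>k c. size_of K q = 2 ^ k \<and> low K q = c * 2 ^ k \<and> q + 1 = k * K + c \<and> 1 \<le> c \<and>
    c < 2 * K \<and> (k = 0 \<or> K \<le> c)"
proof (induction q)
  case 0
  show ?case
    using assms by (intro exI[of _ 0] exI[of _ 1]) simp
next
  case (Suc q)
  then obtain k c where kc: "size_of K q = 2 ^ k" "low K q = c * 2 ^ k" "q + 1 = k * K + c"
      "1 \<le> c" "c < 2 * K" "k = 0 \<or> K \<le> c"
    by blast
  have eq: "low K q + size_of K q = 2 * K * size_of K q \<longleftrightarrow> c + 1 = 2 * K"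
    unfolding kc by (metis add_mult_distrib mult_1 mult_cancel2 power_not_zero zero_neq_numeral)
  show ?case
  proof (cases "c + 1 = 2 * K")
    case True
    have "low K (Suc q) = (c + 1) * 2 ^ k"
      by (simp add: item_Suc kc(1,2))
    then have "low K (Suc q) = K * 2 ^ Suc k"
      unfolding True by simp
    moreover have "size_of K (Suc q) = 2 ^ Suc k"
      using True eq by (simp add: item_Suc(2) kc(1))
    moreover have "Suc q + 1 = Suc k * K + K"
      using True kc(3) by simp
    ultimately show ?thesis
      using assms by (intro exI[of _ "Suc k"] exI[of _ K]) simp
  next
    case False
    then have "size_of K (Suc q) = 2 ^ k"
      using eq by (simp add: item_Suc(2) kc(1))
    moreover have "low K (Suc q) = (c + 1) * 2 ^ k"
      by (simp add: item_Suc kc(1,2))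
    ultimately show ?thesis
      using False kc(3-6) by (intro exI[of _ k] exI[of _ "c + 1"]) auto
  qed
qed

lemma item_bounds:
  assumes "2 \<le> K"
  shows "1 \<le> size_of K q" "size_of K q \<le> low K q" "low K q + size_of K q \<le> 2 * K * size_of K q"
    "size_of K q = 1 \<or> K * size_of K q \<le> low K q"
proof -
  from item_form[OF assms, of q] obtain k c where
    kc: "size_of K q = 2 ^ k" "low K q = c * 2 ^ k" "1 \<le> c" "c < 2 * K" "k = 0 \<or> K \<le> c"
    by blast
  show "1 \<le> size_of K q" "size_of K q \<le> low K q"
    using kc by simp_all
  have "(c + 1) * 2 ^ k \<le> 2 * K * 2 ^ k"
    using kc(4) by (intro mult_le_mono1) simp
  then show "low K q + size_of K q \<le> 2 * K * size_of K q"
    unfolding kc by simp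
  show "size_of K q = 1 \<or> K * size_of K q \<le> low K q"
    using kc(5) unfolding kc(1,2) by auto
qed

lemma item_cover:
  assumes "1 \<le> p"
  shows "\<exists>q. low K q \<le> p \<and> p < low K q + size_of K q"
  using assms
proof (induction p rule: nat_induct_at_least)
  case base
  show ?case
    by (intro exI[of _ 0]) simp
next
  case (Suc p)
  then obtain q where q: "low K q \<le> p" "p < low K q + size_of K q"
    by blast
  have "1 \<le> size_of K q'" for q'
    by (induction q') (auto simp: item_Suc)
  then show ?case
    using q item_Suc(1)[of K q]
    by (cases "Suc p < low K q + size_of K q") (metis le_SucI, metis Suc_leI le_antisym
      less_add_same_cancel1 less_eq_Suc_le not_le_imp_less order_refl One_nat_def)
qed

lemma item_mono: "size_of K q \<le> size_of K (q + d)"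
  by (induction d) (auto simp: item_Suc)

text \<open>Level \<open>k\<close> ends before index \<open>(k + 2) * K\<close>. The first bound is
  crude (it uses only \<open>k < 2 ^ k\<close>) and serves to keep memory addresses linear; the
  second is the logarithmic bound behind the running time, stated with a power to stay within the
  natural numbers.\<close>

lemma item_count:
  assumes "2 \<le> K" "size_of K q \<le> n"
  shows "q < K * (n + 1)" "2 ^ (q div K) \<le> 2 * n"
proof -
  from item_form[OF assms(1), of q] obtain k c where
    kc: "size_of K q = 2 ^ k" "q + 1 = k * K + c" "1 \<le> c" "c < 2 * K"
    by blast
  have "k + 1 \<le> n"
    using assms(2) kc(1) less_exp[of k] by linarith
  have "q < (k + 2) * K"
    using kc by simp
  also have "\<dots> \<le> (n + 1) * K"
    using \<open>k + 1 \<le> n\<close> by (intro mult_le_mono1) simp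
  finally show "q < K * (n + 1)"
    by (simp add: mult.commute)
  have "q div K < k + 2"
    using \<open>q < (k + 2) * K\<close> by (simp add: less_mult_imp_div_less)
  then have "(2::nat) ^ (q div K) \<le> 2 ^ (k + 1)"
    by (intro power_increasing) auto
  then show "2 ^ (q div K) \<le> 2 * n"
    using assms(2) kc(1) by simp
qed

text \<open>An item stores an anchor \<open>E\<close>, a multiple of its size \<open>s\<close> that the text length stays within
  \<open>2 * s\<close> of; the only period \<open>P\<close> in its range for which the text matches itself at distance \<open>P\<close> on
  the last \<open>a * (s - 1)\<close> positions before \<open>E\<close> (\<open>P = 0\<close> if there is none); and the maximal interval
  from \<open>L\<close> to \<open>r\<close> around \<open>E\<close> on which it does so. All zero is a correct initial content.\<close>

definition anchored :: "nat \<Rightarrow> (nat \<Rightarrow> 'a) \<Rightarrow> nat \<Rightarrow> nat \<Rightarrow> nat \<Rightarrow> nat \<Rightarrow> nat \<Rightarrow> bool" where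
  "anchored a f s lo E P L \<longleftrightarrow>
     (0 < P \<longrightarrow> P \<le> L \<and> L \<le> E \<and> matching f P L E) \<and>
     (\<forall>p l. lo \<le> p \<longrightarrow> p < lo + s \<longrightarrow> p + l \<le> E \<longrightarrow> a * (s - 1) \<le> l \<longrightarrow> matching f p (E - l) E \<longrightarrow>
        P = p \<and> L \<le> E - l)"

definition extended :: "(nat \<Rightarrow> 'a) \<Rightarrow> nat \<Rightarrow> nat \<Rightarrow> nat \<Rightarrow> nat \<Rightarrow> bool" where
  "extended f i E P r \<longleftrightarrow>
     (0 < P \<longrightarrow> E \<le> r \<and> r \<le> i \<and> matching f P E r \<and> (r < i \<longrightarrow> f r \<noteq> f (r - P)))"

definition item_inv :: "nat \<Rightarrow> (nat \<Rightarrow> 'a) \<Rightarrow> nat \<Rightarrow> nat \<Rightarrow> nat \<Rightarrow> nat \<Rightarrow> nat \<Rightarrow> nat \<Rightarrow> nat \<Rightarrow> bool" where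
  "item_inv a f i s lo E P L r \<longleftrightarrow>
     s dvd E \<and> E \<le> i \<and> i < E + 2 * s \<and> anchored a f s lo E P L \<and> extended f i E P r"

section \<open>Stability, soundness and completeness of the stored data\<close>

text \<open>A read overwrites the letter at the position just after the processed text, possibly a
  leftover from before a backtrack. The stored data refer to earlier positions only.\<close>

lemma item_inv_cong:
  assumes "item_inv a f i s lo E P L r" and eq: "\<And>z. z < i \<Longrightarrow> f z = g z"
  shows "item_inv a g i s lo E P L r"
proof -
  have m: "matching f p x y = matching g p x y" if "y \<le> i" for p x y
    by (rule matching_cong) (use eq that in auto)
  have "f r = g r" "f (r - P) = g (r - P)" if "r < i"
    using eq that by auto
  moreover have "matching f p x E = matching g p x E" for p x
    using m assms(1) unfolding item_inv_def by simp
  moreover have "matching f P E r = matching g P E r" if "0 < P"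
    using m[of r P E] assms(1) that unfolding item_inv_def extended_def by simp
  ultimately show ?thesis
    using assms(1) unfolding item_inv_def anchored_def extended_def by simp
qed

lemma item_inv_initial: "1 \<le> s \<Longrightarrow> 1 \<le> lo \<Longrightarrow> item_inv a f 0 s lo 0 0 0 0"
  unfolding item_inv_def anchored_def extended_def by auto

text \<open>A multiple of \<open>s\<close> below \<open>s\<close> is 0, and
  \<open>P \<le> L \<le> E = 0\<close> then excludes a stored period. Hence items of size above
  \<open>i + 1\<close> need not be visited when the length changes to \<open>i\<close> from a length
  of at most \<open>i + 1\<close>.\<close>

lemma item_inv_idle:
  assumes "item_inv a f i0 s lo E P L r" "i0 \<le> i + 1" "i + 1 < s" "1 \<le> lo"
  shows "E = 0" "item_inv a f i s lo E P L r"
proof -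
  have "s dvd E" "E < s"
    using assms unfolding item_inv_def by auto
  then show E: "E = 0"
    by (metis dvd_imp_le gr0I not_le)
  have "P = 0"
    using assms(1) unfolding item_inv_def anchored_def E by auto
  with assms E show "item_inv a f i s lo E P L r"
    unfolding item_inv_def anchored_def extended_def by auto
qed

lemma item_inv_sound:
  assumes "item_inv a f i s lo E P L r" "0 < P" "r = i" "a * P \<le> b * (i - L)"
  shows "\<not> free_upto a b f i"
proof -
  have "matching f P L i"
    using assms matching_join unfolding item_inv_def anchored_def extended_def by blast
  moreover have "1 \<le> P" "P \<le> L" "L \<le> i"
    using assms unfolding item_inv_def anchored_def by auto
  ultimately show ?thesis
    using assms(4) unfolding free_upto_def by blast
qed

text \<open>The repetition must end at \<open>i\<close>, since the text without its last letter
  contains none. Its part before the anchor is long enough to be recognized by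
  \<open>anchored\<close>, which yields its period and a left end \<open>L\<close> not to the right
  of \<open>x\<close>. Its part after the anchor leaves no room for the mismatch that would have
  stopped \<open>r\<close> before \<open>i\<close>.\<close>

lemma item_inv_complete:
  assumes a: "1 \<le> a" and b: "1 \<le> b"
    and inv: "\<And>q. size_of (3 * b) q \<le> i \<Longrightarrow>
      item_inv a f i (size_of (3 * b) q) (low (3 * b) q) (E q) (P q) (L q) (r q)"
    and free: "free_upto a b f (i - 1)" "\<not> free_upto a b f i"
  shows "\<exists>q. size_of (3 * b) q \<le> i \<and> 0 < P q \<and> r q = i \<and> a * P q \<le> b * (i - L q)"
proof -
  from free(2) obtain p x y where *: "1 \<le> p" "p \<le> x" "x \<le> y" "y \<le> i" "matching f p x y"
      "a * p \<le> b * (y - x)"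
    unfolding free_upto_def by blast
  have "\<not> y \<le> i - 1"
    using free_upto_length[OF free(1) *(1-3) _ *(5)] *(6) by linarith
  then have y: "y = i" using *(4) by simp
  from item_cover[OF *(1)] obtain q
    where q: "low (3 * b) q \<le> p" "p < low (3 * b) q + size_of (3 * b) q" by blast
  define s lo where "s = size_of (3 * b) q" and "lo = low (3 * b) q"
  have "2 \<le> 3 * b" using b by simp
  from item_bounds[OF this, of q] have s: "1 \<le> s" "s \<le> lo" "s = 1 \<or> 3 * b * s \<le> lo"
    unfolding s_def lo_def by auto
  have si: "s \<le> i"
    using s(2) q(1) * y unfolding lo_def by linarith
  from inv[of q] si have I: "item_inv a f i s lo (E q) (P q) (L q) (r q)"
    unfolding s_def lo_def by simp
  define l where "l = i - x"
  have "a * p \<le> b * l"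
    using *(6) y l_def by simp
  have "1 \<le> l"
    using \<open>a * p \<le> b * l\<close> a *(1) by (cases l) auto
  \<comment> \<open>The share \<open>a * s\<close> of \<open>3 * a * s\<close> covers the threshold,
    and the other two cover the gap between anchor and end because \<open>a \<ge> 1\<close>. Small
    periods below \<open>3 * b\<close> occur only for \<open>s = 1\<close>, where threshold and gap
    add up to 1.\<close>
  have long: "a * (s - 1) + (2 * s - 1) \<le> l"
  proof (cases "s = 1")
    case True
    then show ?thesis using \<open>1 \<le> l\<close> by simp
  next
    case False
    then have "3 * b * s \<le> p"
      using s(3) q(1) unfolding lo_def by simp
    then have "a * (3 * b * s) \<le> b * l"
      using \<open>a * p \<le> b * l\<close> by (meson le_trans mult_le_mono2)
    then have "b * (3 * a * s) \<le> b * l"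
      by (simp add: algebra_simps)
    then have "3 * (a * s) \<le> l"
      using b by simp
    moreover have "a * (s - 1) \<le> a * s" "1 * s \<le> a * s"
      using a by (intro mult_le_mono; simp)+
    ultimately show ?thesis
      by linarith
  qed
  have E: "E q \<le> i" "i < E q + 2 * s"
    using I unfolding item_inv_def by auto
  define l' where "l' = E q - x"
  have l': "a * (s - 1) \<le> l'" "x \<le> E q"
    using long E \<open>1 \<le> l\<close> *(3) y unfolding l'_def l_def by auto
  have "E q - l' = x"
    using l'(2) l'_def by simp
  then have P: "P q = p" "L q \<le> x"
    using I l'(1) q *(2) l'(2) matching_subset[OF *(5), of x "E q"] y E(1)
    unfolding item_inv_def anchored_def s_def lo_def
    by (metis add_le_mono1 le_add_diff_inverse2 l'_def le_refl add.commute)+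
  have "r q = i"
  proof (rule ccontr)
    assume "r q \<noteq> i"
    then have "E q \<le> r q" "r q < i" "f (r q) \<noteq> f (r q - p)"
      using I P(1) *(1) unfolding item_inv_def extended_def by auto
    then show False
      using *(5) l'(2) y unfolding matching_def by auto
  qed
  moreover have "b * (i - x) \<le> b * (i - L q)"
    using P(2) by (intro mult_le_mono2) simp
  then have "a * p \<le> b * (i - L q)"
    using *(6) unfolding y by (rule le_trans[rotated])
  ultimately show ?thesis
    using P(1) *(1) si s_def by (intro exI[of _ q]) auto
qed

section \<open>Skipping periods in the scan\<close>

text \<open>The scan for the candidate period has treated the periods below \<open>p\<close>.\<close>

definition scanned :: "nat \<Rightarrow> (nat \<Rightarrow> 'a) \<Rightarrow> nat \<Rightarrow> nat \<Rightarrow> nat \<Rightarrow> nat \<Rightarrow> nat \<Rightarrow> nat \<Rightarrow> bool" where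
  "scanned a f s lo E p P L \<longleftrightarrow>
     lo \<le> p \<and> (0 < P \<longrightarrow> P \<le> L \<and> L \<le> E \<and> matching f P L E) \<and>
     (\<forall>p' l. lo \<le> p' \<longrightarrow> p' < lo + s \<longrightarrow> p' < p \<longrightarrow> p' + l \<le> E \<longrightarrow> a * (s - 1) \<le> l \<longrightarrow>
        matching f p' (E - l) E \<longrightarrow> P = p' \<and> L \<le> E - l)"

lemma scanned_start: "scanned a f s lo E lo 0 L"
  unfolding scanned_def by auto

lemma scanned_finish: "scanned a f s lo E p P L \<Longrightarrow> lo + s \<le> p \<Longrightarrow> anchored a f s lo E P L"
  unfolding scanned_def anchored_def by auto

text \<open>Let \<open>l = E - x\<close> be the length of the maximal match at distance
  \<open>p\<close>. The next \<open>l div a\<close> periods differ from \<open>p\<close> by so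
  little that a long match for one of them would contradict \<open>matching_conflict\<close>, so the
  scan jumps over them. An accepted \<open>p\<close> excludes the earlier periods in the same
  way.\<close>

lemma scanned_step:
  assumes sc: "scanned a f s lo E p P L" and free: "free_upto a b f E" and ab: "1 \<le> a" "1 \<le> b"
    and p: "1 \<le> lo" "p < lo + s" "x \<le> E" "matching f p x E"
    and far: "E < p \<Longrightarrow> x = E"
    and maximal: "p \<le> E \<Longrightarrow> p \<le> x \<and> (x = p \<or> f (x - 1) \<noteq> f (x - 1 - p))"
  defines "accept \<equiv> \<not> E < p \<and> \<not> E - x < a * (s - 1)"
  shows "scanned a f s lo E (p + (E - x) div a + 1) (if accept then p else P) (if accept then x else L)"
proof -
  \<comment> \<open>Only one of the two matches has to reach the threshold of the item; for the
    other one, \<open>a\<close> times the difference of the two periods suffices. This asymmetry is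
    what permits skipping after a short match.\<close>
  have conflict: False
    if "lo \<le> p1" "p1 < p2" "p2 < lo + s" "p1 + l1 \<le> E" "p2 + l2 \<le> E"
      "matching f p1 (E - l1) E" "matching f p2 (E - l2) E" "a * (p2 - p1) \<le> l1" "a * (s - 1) \<le> l2"
    for p1 p2 l1 l2
  proof -
    have "a * (p2 - p1) \<le> a * (s - 1)"
      using that by (intro mult_le_mono2) simp
    then have "a * (p2 - p1) \<le> min l1 l2"
      using that(8,9) by (meson le_trans min.boundedI)
    then show False
      using that(1-7) matching_conflict[OF free ab(2), of p1 p2 "min l1 l2"]
        matching_subset[of f p1 "E - l1" E "E - min l1 l2" E]
        matching_subset[of f p2 "E - l2" E "E - min l1 l2" E] by linarith
  qed
  have lo: "lo \<le> p" using sc unfolding scanned_def by simp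
  have whole: "E - (E - x) = x" using p(3) by simp
  have current: "accept \<and> x \<le> E - l"
    if "p + l \<le> E" "a * (s - 1) \<le> l" "matching f p (E - l) E" for l
  proof -
    have x: "p \<le> x" "x = p \<or> f (x - 1) \<noteq> f (x - 1 - p)"
      using maximal that(1) by auto
    have "x \<le> E - l"
    proof (rule ccontr)
      assume "\<not> x \<le> E - l"
      then have "E - l \<le> x - 1" "x - 1 < E" "x \<noteq> p"
        using that(1) p(3) by auto
      with that(3) x(2) show False
        unfolding matching_def by blast
    qed
    with that(1,2) show ?thesis
      unfolding accept_def by auto
  qed
  \<comment> \<open>The current match plays the role of the first one: a period inside the jump
    exceeds \<open>p\<close> by at most \<open>(E - x) div a\<close>.\<close>
  have later: False
    if "p < p'" "p' < p + (E - x) div a + 1" "p' < lo + s" "p' + l \<le> E" "a * (s - 1) \<le> l"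
      "matching f p' (E - l) E" for p' l
  proof (rule conflict[OF lo that(1,3) _ that(4) _ that(6) _ that(5)])
    have "p' - p \<le> (E - x) div a" using that(2) by simp
    then show "a * (p' - p) \<le> E - x"
      using ab(1) by (metis less_eq_div_iff_mult_less_eq mult.commute zero_less_one order.strict_trans2)
    show "p + (E - x) \<le> E"
      using maximal that(1,4) p(3) by auto
    show "matching f p (E - (E - x)) E"
      using p(4) whole by simp
  qed
  \<comment> \<open>If \<open>p\<close> is accepted, no earlier period had a long match, so
    overwriting the stored candidate loses nothing.\<close>
  have earlier: "\<not> accept" if "lo \<le> p'" "p' < p" "p' + l \<le> E" "a * (s - 1) \<le> l"
      "matching f p' (E - l) E" for p' l
  proof
    assume acc: accept
    have "a * (p - p') \<le> a * (s - 1)"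
      using that(1) p(2) by (intro mult_le_mono2) simp
    then have "a * (p - p') \<le> l"
      using that(4) by (rule le_trans)
    with acc that maximal p(3,4) whole show False
      unfolding accept_def by (intro conflict[OF that(1,2) p(2) that(3), of "E - x"]) auto
  qed
  have "P' = p' \<and> L' \<le> E - l"
    if "P' = (if accept then p else P)" "L' = (if accept then x else L)" "lo \<le> p'" "p' < lo + s"
      "p' < p + (E - x) div a + 1" "p' + l \<le> E" "a * (s - 1) \<le> l" "matching f p' (E - l) E"
    for P' L' p' l
  proof (cases p' p rule: linorder_cases)
    case less
    then show ?thesis
      using earlier[OF that(3) less that(6-8)] that sc unfolding scanned_def by auto
  next
    case equal
    then show ?thesis
      using current that by auto
  next
    case greater
    then show ?thesis
      using later that by blast
  qed
  moreover have "p \<le> x" if accept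
    using that maximal unfolding accept_def by auto
  ultimately show ?thesis
    using sc p(3,4) lo unfolding scanned_def by auto
qed

section \<open>Programs for one item\<close>

text \<open>Only \<open>rN\<close> and \<open>rBad\<close> persist between operations: the length of the text, and the length of its
  shortest prefix that contains a repetition (\<open>0\<close> if there is none). \<open>rS\<close>, \<open>rLo\<close>, \<open>rQ\<close> are the size, the
  lowest period and the memory address of the current item.\<close>

abbreviation (input) "rN \<equiv> 2 :: nat"
abbreviation (input) "rBad \<equiv> 3 :: nat"
abbreviation (input) "rS \<equiv> 4 :: nat"
abbreviation (input) "rLo \<equiv> 5 :: nat"
abbreviation (input) "rQ \<equiv> 6 :: nat"
abbreviation (input) "rE \<equiv> 7 :: nat"
abbreviation (input) "rP \<equiv> 8 :: nat"
abbreviation (input) "rL \<equiv> 9 :: nat"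
abbreviation (input) "rR \<equiv> 10 :: nat"
abbreviation (input) "rp \<equiv> 11 :: nat"
abbreviation (input) "rx \<equiv> 12 :: nat"
abbreviation (input) "rLim \<equiv> 13 :: nat"
abbreviation (input) "ru \<equiv> 14 :: nat"
abbreviation (input) "rv \<equiv> 15 :: nat"
abbreviation (input) "rHi \<equiv> 16 :: nat"
abbreviation (input) "rTh \<equiv> 17 :: nat"
abbreviation (input) "rZero \<equiv> 18 :: nat"
abbreviation (input) "rOne \<equiv> 19 :: nat"
abbreviation (input) "rA \<equiv> 20 :: nat"
abbreviation (input) "rB \<equiv> 21 :: nat"
abbreviation (input) "rF \<equiv> 22 :: nat"
abbreviation (input) "rHit \<equiv> 23 :: nat"
abbreviation (input) "rEnd \<equiv> 24 :: nat"
abbreviation (input) "rK \<equiv> 25 :: nat"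
abbreviation (input) "rFour \<equiv> 26 :: nat"

abbreviation copy :: "nat \<Rightarrow> nat \<Rightarrow> prog" where
  "copy r i \<equiv> Arith Add r i rZero"

text \<open>A mismatch sets \<open>rLim\<close> to \<open>rx\<close>, which falsifies the loop test;
  this replaces a jump out of the loop and leaves the left end in \<open>rx\<close>.\<close>

definition left_loop :: prog where
  "left_loop = While (Less rLim rx) (block [
     Arith Sub ru rx rOne, Arith Sub rv ru rp, Load_Letter 2 ru, Load_Letter 3 rv,
     If (Same_Letter 2 3) (copy rx ru) (copy rLim rx)])"

definition leftward :: prog where
  "leftward = block [copy rx rE, copy rLim rp, left_loop]"

text \<open>The test of \<open>rE\<close> against \<open>rp\<close> matters for size 1: the
  threshold is then 0, and a period exceeding the anchor would be accepted with an empty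
  match.\<close>

definition search_loop :: prog where
  "search_loop = While (Less rp rHi) (block [
     leftward, Arith Sub rv rE rx,
     If (Less rE rp) Skip (If (Less rv rTh) Skip (block [copy rP rp, copy rL rx])),
     Arith Div rv rv rA, Arith Add rp rp rv, Arith Add rp rp rOne])"

definition search :: prog where
  "search = block [
     Arith Add rHi rLo rS, copy rp rLo, copy rP rZero, Arith Sub ru rS rOne, Arith Mul rTh rA ru,
     search_loop, copy rR rE]"

definition right_loop :: prog where
  "right_loop = While (Less rR rLim) (block [
     Arith Sub rv rR rP, Load_Letter 2 rR, Load_Letter 3 rv,
     If (Same_Letter 2 3) (Arith Add rR rR rOne) (copy rLim rR)])"

definition rightward :: prog where
  "rightward = block [copy rLim rN, right_loop]"

section \<open>Correctness and cost of the comparisons and the scan\<close>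

text \<open>Letter registers are left unconstrained, because they are scratch space between two
  comparisons.\<close>

definition frame :: "nat set \<Rightarrow> 'a state \<Rightarrow> 'a state \<Rightarrow> bool" where
  "frame X s s' \<longleftrightarrow> mem s' = mem s \<and> lmem s' = lmem s \<and> (\<forall>r. r \<notin> X \<longrightarrow> reg s' r = reg s r)"

definition const_regs :: "nat \<Rightarrow> nat \<Rightarrow> 'a state \<Rightarrow> bool" where
  "const_regs a b s \<longleftrightarrow> reg s rZero = 0 \<and> reg s rOne = 1 \<and> reg s rA = a \<and> reg s rB = b \<and>
     reg s rK = 6 * b \<and> reg s rFour = 4"

lemma matching_left:
  assumes "matching f p x y" "f (x - 1) = f (x - 1 - p)"
  shows "matching f p (x - 1) y"
  unfolding matching_def
proof (intro allI impI)
  fix z assume "x - 1 \<le> z" "z < y"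
  then show "f z = f (z - p)"
    using assms by (cases "z = x - 1") (auto simp: matching_def)
qed

lemma matching_right:
  assumes "matching f p x y" "f y = f (y - p)"
  shows "matching f p x (Suc y)"
  using assms by (auto simp: matching_def less_Suc_eq)

text \<open>\<open>M\<close> bounds the text length. The first bound on \<open>W\<close> covers the
  products with \<open>a\<close>, for periods and thresholds. The second covers the periods reached
  by a scan, which stay below \<open>12 * b * (M + 2)\<close>, the products with \<open>b\<close>
  and all addresses. Visited items have index below \<open>3 * b * (M + 2)\<close> and occupy four
  cells each, whence the bound on \<open>S\<close>.\<close>

locale resources =
  fixes a b M S W :: nat
  assumes a: "1 \<le> a" and b: "1 \<le> b"
    and W: "a * (M + 2) < W" "24 * b * (M + 2) + 10 < W"
    and S: "12 * b * (M + 2) \<le> S"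
begin

lemma M_le: "M + 2 \<le> b * (M + 2)" "M + 2 \<le> S" "12 * M + 24 < W"
proof -
  have "1 * (M + 2) \<le> b * (M + 2)"
    using b by (rule mult_le_mono1)
  then show "M + 2 \<le> b * (M + 2)" "M + 2 \<le> S" "12 * M + 24 < W"
    using S W(2) by (simp_all add: mult.assoc)
qed

lemma left_loop_wp:
  assumes "const_regs a b s" "reg s rE = E" "reg s rp = p" "reg s rx = E" "reg s rLim = p"
    and E: "E \<le> M" and f: "lmem s = f"
  shows "wp S W left_loop (\<lambda>t s'. frame {rx, rLim, ru, rv} s s' \<and> reg s' rx \<le> E \<and>
     matching f p (reg s' rx) E \<and> (E < p \<longrightarrow> reg s' rx = E) \<and>
     (p \<le> E \<longrightarrow> p \<le> reg s' rx \<and> (reg s' rx = p \<or> f (reg s' rx - 1) \<noteq> f (reg s' rx - 1 - p))) \<and>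
     t \<le> 8 * (E - reg s' rx) + 10) s"
  unfolding left_loop_def
\<comment> \<open>One round with its test costs 8 steps. The additional 1 pays for the round that
  meets a mismatch and leaves \<open>rx\<close> unchanged.\<close>
proof (rule wp_While[where V = "\<lambda>s'. 8 * (reg s' rx + (if reg s' rLim < reg s' rx then 1 else 0))"
      and I = "\<lambda>s'. frame {rx, rLim, ru, rv} s s' \<and> reg s' rx \<le> E \<and>
        matching f p (reg s' rx) E \<and> (E < p \<longrightarrow> reg s' rx = E) \<and> (p \<le> E \<longrightarrow> p \<le> reg s' rx) \<and>
        (reg s' rLim = p \<or> reg s' rLim = reg s' rx \<and> p < reg s' rx \<and>
           f (reg s' rx - 1) \<noteq> f (reg s' rx - 1 - p))"], goal_cases)
  case 1
  then show ?case
    using assms by (auto simp: frame_def)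
next
  case (2 s')
  let ?x = "reg s' rx"
  have *: "reg s' rLim = p" "p < ?x" "?x \<le> E" "E < W" "E \<le> S" "lmem s' = f" "reg s' rp = p"
      "reg s' rOne = 1" "reg s' rZero = 0"
    using 2 assms M_le by (auto simp: frame_def const_regs_def)
  show ?case
  proof (cases "f (?x - 1) = f (?x - 1 - p)")
    case True
    then have "matching f p (?x - 1) E"
      using 2(1) matching_left by blast
    with True * 2(1) show ?thesis
      by (auto simp: frame_def)
  next
    case False
    with * 2(1) show ?thesis
      by (auto simp: frame_def)
  qed
next
  case (3 t s')
  then have "t \<le> 8 * (E - reg s' rx) + 10"
    using assms(4) by (auto split: if_splits)
  with 3 show ?case
    by auto
qed

lemma leftward_wp:
  assumes "const_regs a b s" "reg s rE = E" "reg s rp = p" and E: "E \<le> M" "p < W" and f: "lmem s = f"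
  shows "wp S W leftward (\<lambda>t s'. frame {rx, rLim, ru, rv} s s' \<and> reg s' rx \<le> E \<and>
     matching f p (reg s' rx) E \<and> (E < p \<longrightarrow> reg s' rx = E) \<and>
     (p \<le> E \<longrightarrow> p \<le> reg s' rx \<and> (reg s' rx = p \<or> f (reg s' rx - 1) \<noteq> f (reg s' rx - 1 - p))) \<and>
     t \<le> 8 * (E - reg s' rx) + 13) s"
proof -
  let ?s = "s\<lparr>reg := (reg s)(rx := E, rLim := p)\<rparr>"
  have "wp S W left_loop (\<lambda>t s'. frame {rx, rLim, ru, rv} ?s s' \<and> reg s' rx \<le> E \<and>
     matching f p (reg s' rx) E \<and> (E < p \<longrightarrow> reg s' rx = E) \<and>
     (p \<le> E \<longrightarrow> p \<le> reg s' rx \<and> (reg s' rx = p \<or> f (reg s' rx - 1) \<noteq> f (reg s' rx - 1 - p))) \<and>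
     t \<le> 8 * (E - reg s' rx) + 10) ?s"
    by (rule left_loop_wp) (use assms in \<open>auto simp: const_regs_def\<close>)
  moreover have "reg s rZero = 0" "E < W"
    using assms M_le by (auto simp: const_regs_def)
  ultimately show ?thesis
    using assms by (auto simp: leftward_def frame_def elim!: wp_mono)
qed

text \<open>Comparing \<open>E - x\<close> letters costs \<open>O(a * (d + 1))\<close> with
  \<open>d = (E - x) div a\<close>, and the scan then advances by \<open>d + 1\<close>. The total
  cost is thus proportional to the distance that the scanned period travels.\<close>

lemma search_loop_wp:
  fixes s :: "'a state"
  assumes "const_regs a b s" "reg s rE = E" "reg s rp = lo" "reg s rHi = lo + n" "reg s rP = 0"
    "reg s rTh = a * (n - 1)"
    and E: "E \<le> M" "1 \<le> lo" and f: "lmem s = f" "free_upto a b f E"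
    and hi: "lo + n \<le> 6 * b * (M + 2)"
  shows "wp S W search_loop (\<lambda>t s'. frame {rx, rLim, ru, rv, rp, rP, rL} s s' \<and>
     anchored a f n lo E (reg s' rP) (reg s' rL) \<and> t \<le> 80 * a * (lo + n) + 1) s"
  unfolding search_loop_def
\<comment> \<open>The last jump may pass \<open>lo + n\<close>, but each jump at most doubles the
  period; hence the factor 2.\<close>
proof (rule wp_While[where V = "\<lambda>s'. 40 * a * (2 * (lo + n) - reg s' rp)"
      and I = "\<lambda>s'. frame {rx, rLim, ru, rv, rp, rP, rL} s s' \<and>
        scanned a f n lo E (reg s' rp) (reg s' rP) (reg s' rL) \<and> reg s' rp \<le> 2 * (lo + n)"], goal_cases)
  case 1
  then show ?case
    using assms scanned_start by (auto simp: frame_def)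
next
  case (2 s')
  let ?p = "reg s' rp"
  have regs: "const_regs a b s'" "reg s' rE = E" "reg s' rHi = lo + n" "lmem s' = f"
      "reg s' rTh = a * (n - 1)"
    using 2 assms by (auto simp: frame_def const_regs_def)
  have p: "?p < lo + n" "lo \<le> ?p" "?p < W"
    using 2 regs hi W(2) by (auto simp: scanned_def)
  have "wp S W leftward (\<lambda>t s1. frame {rx, rLim, ru, rv} s' s1 \<and> reg s1 rx \<le> E \<and>
     matching f ?p (reg s1 rx) E \<and> (E < ?p \<longrightarrow> reg s1 rx = E) \<and>
     (?p \<le> E \<longrightarrow> ?p \<le> reg s1 rx \<and> (reg s1 rx = ?p \<or> f (reg s1 rx - 1) \<noteq> f (reg s1 rx - 1 - ?p))) \<and>
     t \<le> 8 * (E - reg s1 rx) + 13) s'"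
    by (rule leftward_wp) (use regs E p in auto)
  then show ?case
    unfolding block.simps wp_Seq
  proof (rule wp_mono, elim conjE)
    fix t :: nat and s1 :: "'a state"
    let ?x = "reg s1 rx"
    assume s1: "frame {rx, rLim, ru, rv} s' s1" and x: "?x \<le> E" "matching f ?p ?x E"
      "E < ?p \<longrightarrow> ?x = E"
      "?p \<le> E \<longrightarrow> ?p \<le> ?x \<and> (?x = ?p \<or> f (?x - 1) \<noteq> f (?x - 1 - ?p))"
      and t: "t \<le> 8 * (E - ?x) + 13"
    define d where "d = (E - ?x) div a"
    define accept where "accept \<longleftrightarrow> \<not> E < ?p \<and> \<not> E - ?x < a * (n - 1)"
    have "scanned a f n lo E (?p + d + 1) (if accept then ?p else reg s' rP)
        (if accept then ?x else reg s' rL)"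
      unfolding d_def accept_def
      by (rule scanned_step[OF _ f(2) a b E(2)]) (use 2(1) p(1) x in auto)
    \<comment> \<open>Repetition-freeness before \<open>E\<close> bounds the match by
      \<open>b * (E - x) < a * p\<close>, so the jump is shorter than the period itself.\<close>
    moreover have "d < ?p"
    proof (cases "?p \<le> E")
      case True
      with x p E(2) have "b * (E - ?x) < a * ?p"
        by (intro free_upto_length[OF f(2)]) auto
      moreover have "1 * (E - ?x) \<le> b * (E - ?x)"
        using b by (rule mult_le_mono1)
      ultimately have "E - ?x < ?p * a"
        unfolding mult.commute[of ?p a] by linarith
      then show ?thesis
        unfolding d_def by (rule less_mult_imp_div_less)
    next
      case False
      with x p E(2) show ?thesis
        unfolding d_def by simp
    qed
    moreover have "t + 27 + 40 * a * (2 * (lo + n) - (?p + d + 1)) \<le> 40 * a * (2 * (lo + n) - ?p)"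
    proof -
      have "E - ?x + 1 \<le> a * (d + 1)"
        using dividend_less_div_times[of a "E - ?x"] a unfolding d_def by (simp add: mult.commute)
      then have "t + 27 \<le> 40 * a * (d + 1)"
        using t by simp
      moreover have "2 * (lo + n) - ?p = 2 * (lo + n) - (?p + d + 1) + (d + 1)"
        using \<open>d < ?p\<close> p by simp
      then have "40 * a * (2 * (lo + n) - ?p) = 40 * a * (2 * (lo + n) - (?p + d + 1)) + 40 * a * (d + 1)"
        by (metis add_mult_distrib2)
      ultimately show ?thesis
        by linarith
    qed
    moreover have "?x < W" "E - ?x < W" "d < W" "?p + d + 1 < W"
      using x(1) E(1) M_le(3) \<open>d < ?p\<close> p hi W(2) by linarith+
    ultimately show "wp S W (Arith Sub rv rE rx) (\<lambda>t1 s1. wp S W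
        (If (Less rE rp) Skip (If (Less rv rTh) Skip (Seq (copy rP rp) (Seq (copy rL rx) Skip))))
        (\<lambda>t2 s2. wp S W (Arith Div rv rv rA) (\<lambda>t3 s3. wp S W (Arith Add rp rp rv)
        (\<lambda>t4 s4. wp S W (Arith Add rp rp rOne) (\<lambda>t5 s5. wp S W Skip (\<lambda>t6 s6.
          (frame {rx, rLim, ru, rv, rp, rP, rL} s s6 \<and>
           scanned a f n lo E (reg s6 rp) (reg s6 rP) (reg s6 rL) \<and> reg s6 rp \<le> 2 * (lo + n)) \<and>
          t + (t1 + (t2 + (t3 + (t4 + (t5 + t6))))) + 1 + 40 * a * (2 * (lo + n) - reg s6 rp)
            \<le> 40 * a * (2 * (lo + n) - reg s' rp)) s5) s4) s3) s2) s1) s1"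
      using s1 2(1) p regs
      by (auto simp: frame_def const_regs_def accept_def simp flip: d_def split: if_splits)
  qed
next
  case (3 t s')
  have "40 * a * (2 * (lo + n) - lo) \<le> 40 * a * (2 * (lo + n))"
    by (intro mult_le_mono2) simp
  then have "t \<le> 80 * a * (lo + n) + 1"
    using 3(3)[unfolded assms(3)] by linarith
  with 3 show ?case
    using assms scanned_finish[of a f n lo E "reg s' rp" "reg s' rP" "reg s' rL"]
    by (auto simp: frame_def)
qed

lemma search_wp:
  fixes s :: "'a state"
  assumes "const_regs a b s" "reg s rE = E" "reg s rLo = lo" "reg s rS = n"
    and E: "E \<le> M" "1 \<le> lo" and f: "lmem s = f" "free_upto a b f E"
    and hi: "lo + n \<le> 6 * b * (M + 2)" "n \<le> M + 1"
  shows "wp S W search (\<lambda>t s'. frame {rx, rLim, ru, rv, rp, rP, rL, rHi, rTh, rR} s s' \<and>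
     anchored a f n lo E (reg s' rP) (reg s' rL) \<and> reg s' rR = E \<and> t \<le> 80 * a * (lo + n) + 8) s"
proof -
  let ?s = "s\<lparr>reg := (reg s)(rHi := lo + n, rp := lo, rP := 0, ru := n - 1, rTh := a * (n - 1))\<rparr>"
  have "wp S W search_loop (\<lambda>t s'. frame {rx, rLim, ru, rv, rp, rP, rL} ?s s' \<and>
     anchored a f n lo E (reg s' rP) (reg s' rL) \<and> t \<le> 80 * a * (lo + n) + 1) ?s"
    by (rule search_loop_wp) (use assms in \<open>auto simp: const_regs_def\<close>)
  moreover have "a * (n - 1) \<le> a * (M + 2)"
    using hi(2) by (intro mult_le_mono2) simp
  then have "a * (n - 1) < W" "lo + n < W" "E < W" "0 < W"
    using W hi(1) E M_le(3) by linarith+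
  ultimately show ?thesis
    using assms by (auto simp: search_def frame_def const_regs_def elim!: wp_mono)
qed

lemma right_loop_wp:
  fixes s :: "'a state"
  assumes "const_regs a b s" "reg s rR = r" "reg s rP = P" "reg s rLim = i" "r \<le> i"
    and i: "i \<le> M" and f: "lmem s = f"
  shows "wp S W right_loop (\<lambda>t s'. frame {rv, rLim, rR} s s' \<and> r \<le> reg s' rR \<and> reg s' rR \<le> i \<and>
     matching f P r (reg s' rR) \<and> (reg s' rR < i \<longrightarrow> f (reg s' rR) \<noteq> f (reg s' rR - P)) \<and>
     t \<le> 7 * (reg s' rR - r) + 8) s"
  unfolding right_loop_def
proof (rule wp_While[where V = "\<lambda>s'. 7 * (i - reg s' rR + (if reg s' rR < reg s' rLim then 1 else 0))"
      and I = "\<lambda>s'. frame {rv, rLim, rR} s s' \<and> r \<le> reg s' rR \<and> reg s' rR \<le> i \<and>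
        matching f P r (reg s' rR) \<and> (reg s' rLim = i \<or> reg s' rLim = reg s' rR \<and> reg s' rR < i \<and>
          f (reg s' rR) \<noteq> f (reg s' rR - P))"], goal_cases)
  case 1
  then show ?case
    using assms by (auto simp: frame_def)
next
  case (2 s')
  let ?x = "reg s' rR"
  have *: "reg s' rLim = i" "?x < i" "r \<le> ?x" "i + 1 < W" "i \<le> S" "lmem s' = f" "reg s' rP = P"
      "reg s' rOne = 1" "reg s' rZero = 0"
    using 2 assms M_le by (auto simp: frame_def const_regs_def)
  show ?case
  proof (cases "f ?x = f (?x - P)")
    case True
    then have "matching f P r (Suc ?x)"
      using 2(1) matching_right by blast
    with True * 2(1) show ?thesis
      by (auto simp: frame_def)
  next
    case False
    with * 2(1) show ?thesis
      by (auto simp: frame_def)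
  qed
next
  case (3 t s')
  then have "t \<le> 7 * (reg s' rR - r) + 8"
    using assms(2,5) by (auto split: if_splits)
  with 3 show ?case
    by auto
qed

lemma rightward_wp:
  fixes s :: "'a state"
  assumes "const_regs a b s" "reg s rR = r" "reg s rP = P" "reg s rN = i" "r \<le> i"
    and i: "i \<le> M" and f: "lmem s = f"
  shows "wp S W rightward (\<lambda>t s'. frame {rv, rLim, rR} s s' \<and> r \<le> reg s' rR \<and> reg s' rR \<le> i \<and>
     matching f P r (reg s' rR) \<and> (reg s' rR < i \<longrightarrow> f (reg s' rR) \<noteq> f (reg s' rR - P)) \<and>
     t \<le> 7 * (reg s' rR - r) + 10) s"
proof -
  let ?s = "s\<lparr>reg := (reg s)(rLim := i)\<rparr>"
  have "wp S W right_loop (\<lambda>t s'. frame {rv, rLim, rR} ?s s' \<and> r \<le> reg s' rR \<and> reg s' rR \<le> i \<and>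
     matching f P r (reg s' rR) \<and> (reg s' rR < i \<longrightarrow> f (reg s' rR) \<noteq> f (reg s' rR - P)) \<and>
     t \<le> 7 * (reg s' rR - r) + 8) ?s"
    by (rule right_loop_wp) (use assms in \<open>auto simp: const_regs_def\<close>)
  moreover have "i < W"
    using i M_le(3) by linarith
  ultimately show ?thesis
    using assms by (auto simp: rightward_def frame_def const_regs_def elim!: wp_mono)
qed

end

section \<open>Moving an anchor and updating one item\<close>

definition choose_anchor :: prog where
  "choose_anchor = block [
     copy rF rE, Arith Add rv rS rS, Arith Add rv rE rv,
     If (Less rN rE) (Arith Sub rE rE rS) (If (Less rN rv) Skip (Arith Add rE rE rS))]"

definition reanchor :: prog where
  "reanchor = block [
     choose_anchor,
     If (Equal rE rF) Skip search,
     If (Less rN rR) (copy rR rN) Skip]"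

definition advance :: prog where
  "advance = If (Less rZero rP) (block [
     rightward,
     If (Equal rR rN) (block [
       Arith Sub ru rN rL, Arith Mul ru rB ru, Arith Mul rv rA rP,
       If (Less ru rv) Skip (copy rHit rOne)]) Skip]) Skip"

definition load_item :: prog where
  "load_item = block [
     Load rE rQ, Arith Add ru rQ rOne, Load rP ru, Arith Add ru ru rOne, Load rL ru,
     Arith Add ru ru rOne, Load rR ru]"

definition store_item :: prog where
  "store_item = block [
     Store rQ rE, Arith Add ru rQ rOne, Store ru rP, Arith Add ru ru rOne, Store ru rL,
     Arith Add ru ru rOne, Store ru rR]"

definition update_item :: prog where
  "update_item = block [load_item, reanchor, advance, store_item]"

definition next_anchor :: "nat \<Rightarrow> nat \<Rightarrow> nat \<Rightarrow> nat" where
  "next_anchor i n E = (if i < E then E - n else if i < E + 2 * n then E else E + n)"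

context resources
begin

text \<open>A new search costs \<open>80 * a * (lo + n)\<close> up to a constant, and
  \<open>lo + n \<le> 6 * b * n\<close> turns this into \<open>480 * a * b * n\<close>. The
  \<open>14 * n\<close> is the cost 7 of a comparison times the at most \<open>2 * n\<close> letters
  after a new anchor.\<close>

definition item_time :: "nat \<Rightarrow> nat \<Rightarrow> nat \<Rightarrow> nat" where
  "item_time i n E = 100 + (if next_anchor i n E = E then 0 else (480 * a * b + 14) * n)"

text \<open>Only the shorter text is assumed free: a read may create a repetition, and a backtrack
  that wakes the items has just removed one.\<close>

definition adjacent :: "(nat \<Rightarrow> 'a) \<Rightarrow> nat \<Rightarrow> nat \<Rightarrow> bool" where
  "adjacent f i0 i \<longleftrightarrow> (i = i0 + 1 \<or> i0 = i + 1) \<and> free_upto a b f (min i0 i)"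

text \<open>A new anchor lies within the shorter of the two texts, so the search that follows works
  before an anchor where the text is free. In a left move the old anchor is a positive multiple of
  \<open>n\<close>, hence \<open>n \<le> E\<close> and the subtraction is not truncated.\<close>

lemma next_anchor_bounds:
  assumes "n dvd E" "E \<le> i0" "i0 < E + 2 * n" "1 \<le> n" "i = i0 + 1 \<or> i0 = i + 1"
  defines "E' \<equiv> next_anchor i n E"
  shows "n dvd E'" "E' \<le> i" "i < E' + 2 * n" "i - E' \<le> 2 * n" "E' \<noteq> E \<Longrightarrow> E' \<le> min i0 i"
    "E' = E \<or> E' = E + n \<or> n \<le> E \<and> E' = E - n"
proof -
  have "n \<le> E" if "i < E"
    using assms(1) that by (auto intro: dvd_imp_le)
  then show "n dvd E'" "E' \<le> i" "i < E' + 2 * n" "i - E' \<le> 2 * n" "E' \<noteq> E \<Longrightarrow> E' \<le> min i0 i"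
    "E' = E \<or> E' = E + n \<or> n \<le> E \<and> E' = E - n"
    using assms(1-5) unfolding E'_def next_anchor_def by (auto intro: dvd_diff_nat)
qed

text \<open>The final disjunction limits the extension that follows: either few letters remain after
  \<open>rR\<close>, or the mismatch there is already known. Together with the case distinction on
  the anchor it gives constant cost without a move and cost \<open>O(n)\<close> with one.\<close>

lemma reanchor_wp:
  fixes s :: "'a state"
  assumes regs: "const_regs a b s" "reg s rE = E" "reg s rP = P" "reg s rL = L" "reg s rR = r"
      "reg s rN = i" "reg s rS = n" "reg s rLo = lo" "lmem s = f"
    and inv: "item_inv a f i0 n lo E P L r"
    and adj: "adjacent f i0 i" "i0 \<le> M" "i \<le> M"
    and n: "1 \<le> n" "n \<le> lo" "lo + n \<le> 6 * b * n" "n \<le> i + 1"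
  shows "wp S W reanchor (\<lambda>t s'. frame {rx, rLim, ru, rv, rp, rE, rP, rL, rF, rHi, rTh, rR} s s' \<and>
     reg s' rE = next_anchor i n E \<and> anchored a f n lo (reg s' rE) (reg s' rP) (reg s' rL) \<and>
     (0 < reg s' rP \<longrightarrow> reg s' rE \<le> reg s' rR \<and> reg s' rR \<le> i \<and>
       matching f (reg s' rP) (reg s' rE) (reg s' rR) \<and>
       (i - reg s' rR \<le> (if reg s' rE = E then 1 else 2 * n) \<or>
        f (reg s' rR) \<noteq> f (reg s' rR - reg s' rP))) \<and>
     t \<le> 22 + (if reg s' rE = E then 0 else 480 * a * b * n)) s"
proof -
  have I: "n dvd E" "E \<le> i0" "i0 < E + 2 * n" "anchored a f n lo E P L" "extended f i0 E P r"
    using inv unfolding item_inv_def by auto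
  define E' where "E' = next_anchor i n E"
  have adj': "i = i0 + 1 \<or> i0 = i + 1"
    using adj(1) unfolding adjacent_def by simp
  note E' = next_anchor_bounds[OF I(1-3) n(1) adj', folded E'_def]
  have W': "E < W" "n + n < W" "E + (n + n) < W" "E' < W" "E + n < W" "i < W"
    using M_le(3) I(2) adj(2,3) n(4) E'(2) by linarith+
  have "wp S W choose_anchor (\<lambda>t s'. frame {rF, rv, rE} s s' \<and> reg s' rF = E \<and> reg s' rE = E' \<and>
      t \<le> 8) s"
    using regs W' unfolding E'_def next_anchor_def
    by (auto simp: choose_anchor_def frame_def const_regs_def)
  then show ?thesis
    unfolding reanchor_def block.simps
  proof (rule wp_SeqI, elim conjE)
    fix t1 :: nat and s1 :: "'a state"
    assume fr: "frame {rF, rv, rE} s s1" and s1: "reg s1 rF = E" "reg s1 rE = E'" and t1: "t1 \<le> 8"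
    show "wp S W (Seq (If (Equal rE rF) Skip search) (Seq (If (Less rN rR) (copy rR rN) Skip) Skip))
      (\<lambda>t2 s'. frame {rx, rLim, ru, rv, rp, rE, rP, rL, rF, rHi, rTh, rR} s s' \<and>
       reg s' rE = next_anchor i n E \<and> anchored a f n lo (reg s' rE) (reg s' rP) (reg s' rL) \<and>
       (0 < reg s' rP \<longrightarrow> reg s' rE \<le> reg s' rR \<and> reg s' rR \<le> i \<and>
         matching f (reg s' rP) (reg s' rE) (reg s' rR) \<and>
         (i - reg s' rR \<le> (if reg s' rE = E then 1 else 2 * n) \<or>
          f (reg s' rR) \<noteq> f (reg s' rR - reg s' rP))) \<and>
       t1 + t2 \<le> 22 + (if reg s' rE = E then 0 else 480 * a * b * n)) s1"
    proof (cases "E' = E")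
      case True
      then have "\<not> i < E" "i < E + 2 * n"
        using E'(2,3) by auto
      \<comment> \<open>If \<open>r = i0\<close>, at most the letter of this operation lies beyond
        the clamped end. If \<open>r < i0\<close>, the mismatch at \<open>r\<close> persists, unless
        a backtrack has just removed that letter; then \<open>r = i\<close> and nothing remains to
        be compared.\<close>
      then have "E \<le> min r i \<and> min r i \<le> i \<and> matching f P E (min r i) \<and>
          (i - min r i \<le> 1 \<or> f (min r i) \<noteq> f (min r i - P))" if "0 < P"
        using I(5) that adj' matching_subset[of f P E r E "min r i"]
        unfolding extended_def by (auto simp: min_def)
      then show ?thesis
        using True regs W' I(4) fr s1 t1 unfolding E'_def
        by (auto simp: frame_def const_regs_def min_def)
    next
      case False
      have "480 * a * b * n = 80 * a * (6 * b * n)"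
        by simp
      then have t: "80 * a * (lo + n) \<le> 480 * a * b * n"
        using n(3) by (metis mult_le_mono2)
      have "6 * b * n \<le> 6 * b * (M + 2)"
        using n(4) adj(3) by (intro mult_le_mono2) simp
      then have "wp S W search (\<lambda>t s'. frame {rx, rLim, ru, rv, rp, rP, rL, rHi, rTh, rR} s1 s' \<and>
          anchored a f n lo E' (reg s' rP) (reg s' rL) \<and> reg s' rR = E' \<and>
          t \<le> 80 * a * (lo + n) + 8) s1"
        using regs n adj E'(2) free_upto_mono[of a b f "min i0 i" E'] E'(5)[OF False] fr s1
        by (intro search_wp) (auto simp: const_regs_def adjacent_def frame_def)
      then have "wp S W search (\<lambda>t s'. frame {rx, rLim, ru, rv, rp, rP, rL, rHi, rTh, rR} s1 s' \<and>
          anchored a f n lo E' (reg s' rP) (reg s' rL) \<and> reg s' rR = E' \<and>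
          t \<le> 480 * a * b * n + 8) s1"
        by (rule wp_mono) (elim conjE, intro conjI, assumption+, use t in linarith)
      then have "wp S W (If (Equal rE rF) Skip search)
        (\<lambda>t s'. frame {rx, rLim, ru, rv, rp, rP, rL, rHi, rTh, rR} s1 s' \<and>
          anchored a f n lo E' (reg s' rP) (reg s' rL) \<and> reg s' rR = E' \<and>
          t \<le> 480 * a * b * n + 9) s1"
        using False s1 by (auto elim!: wp_mono)
      then show ?thesis
      proof (rule wp_SeqI, elim conjE)
        fix t2 :: nat and s2 :: "'a state"
        assume "frame {rx, rLim, ru, rv, rp, rP, rL, rHi, rTh, rR} s1 s2"
          "anchored a f n lo E' (reg s2 rP) (reg s2 rL)" "reg s2 rR = E'" "t2 \<le> 480 * a * b * n + 9"
        then show "wp S W (Seq (If (Less rN rR) (copy rR rN) Skip) Skip)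
          (\<lambda>t3 s'. frame {rx, rLim, ru, rv, rp, rE, rP, rL, rF, rHi, rTh, rR} s s' \<and>
           reg s' rE = next_anchor i n E \<and> anchored a f n lo (reg s' rE) (reg s' rP) (reg s' rL) \<and>
           (0 < reg s' rP \<longrightarrow> reg s' rE \<le> reg s' rR \<and> reg s' rR \<le> i \<and>
             matching f (reg s' rP) (reg s' rE) (reg s' rR) \<and>
             (i - reg s' rR \<le> (if reg s' rE = E then 1 else 2 * n) \<or>
              f (reg s' rR) \<noteq> f (reg s' rR - reg s' rP))) \<and>
           t1 + (t2 + t3) \<le> 22 + (if reg s' rE = E then 0 else 480 * a * b * n)) s2"
          using fr s1 t1 regs E'(2,4) False by (auto simp: frame_def simp flip: E'_def)
      qed
    qed
  qed
qed

text \<open>\<open>d\<close> bounds the number of letters by which the match can grow. A known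
  mismatch at \<open>r\<close> makes the growth zero, however far \<open>r\<close> is from the end
  of the text.\<close>

lemma advance_wp:
  fixes s :: "'a state"
  assumes regs: "const_regs a b s" "reg s rE = E" "reg s rP = P" "reg s rL = L" "reg s rR = r"
      "reg s rN = i" "lmem s = f"
    and E: "0 < P \<Longrightarrow> P \<le> L \<and> L \<le> E \<and> E \<le> r \<and> r \<le> i \<and> matching f P E r" "E \<le> i" "i \<le> M"
    and close: "0 < P \<Longrightarrow> i - r \<le> d \<or> f r \<noteq> f (r - P)"
    and W_b: "b * (M + 2) < W"
  shows "wp S W advance (\<lambda>t s'. frame {ru, rv, rLim, rR, rHit} s s' \<and> extended f i E P (reg s' rR) \<and>
     reg s' rHit = (if 0 < P \<and> reg s' rR = i \<and> a * P \<le> b * (i - L) then 1 else reg s rHit) \<and>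
     t \<le> 7 * d + 30) s"
proof (cases "0 < P")
  case False
  then show ?thesis
    using regs by (auto simp: advance_def frame_def extended_def const_regs_def)
next
  case True
  have "wp S W rightward (\<lambda>t s'. frame {rv, rLim, rR} s s' \<and> r \<le> reg s' rR \<and> reg s' rR \<le> i \<and>
     matching f P r (reg s' rR) \<and> (reg s' rR < i \<longrightarrow> f (reg s' rR) \<noteq> f (reg s' rR - P)) \<and>
     t \<le> 7 * (reg s' rR - r) + 10) s"
    by (rule rightward_wp) (use regs E True in auto)
  then have *: "wp S W rightward (\<lambda>t s'. frame {rv, rLim, rR} s s' \<and> extended f i E P (reg s' rR) \<and>
     t \<le> 7 * d + 10) s"
  proof (rule wp_mono, elim conjE, intro conjI)
    fix t :: nat and s' :: "'a state"
    assume s': "r \<le> reg s' rR" "reg s' rR \<le> i" "matching f P r (reg s' rR)"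
      "reg s' rR < i \<longrightarrow> f (reg s' rR) \<noteq> f (reg s' rR - P)" "t \<le> 7 * (reg s' rR - r) + 10"
    then show "extended f i E P (reg s' rR)"
      using E(1) True matching_join[of f P E r "reg s' rR"] unfolding extended_def by auto
    \<comment> \<open>Any growth at all refutes a mismatch at \<open>r\<close>, so the other
      alternative of \<open>close\<close> holds.\<close>
    have "reg s' rR - r \<le> d"
    proof (cases "reg s' rR = r")
      case False
      then have "f r = f (r - P)"
        using s'(1,3) by (simp add: matching_def)
      then show ?thesis
        using close True s'(2) by auto
    qed simp
    then show "t \<le> 7 * d + 10"
      using s'(5) by linarith
  qed
  have "i - L \<le> M + 2" "P \<le> M + 2"
    using E(2,3) E(1)[OF True] by linarith+
  then have W': "b * (i - L) < W" "a * P < W" "i - L < W" "1 < W"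
    using mult_le_mono2[of "i - L" "M + 2" b] mult_le_mono2[of P "M + 2" a] W(1) W_b M_le(3)
    by linarith+
  have "wp S W (block [rightward,
     If (Equal rR rN) (block [
       Arith Sub ru rN rL, Arith Mul ru rB ru, Arith Mul rv rA rP,
       If (Less ru rv) Skip (copy rHit rOne)]) Skip])
    (\<lambda>t s'. frame {ru, rv, rLim, rR, rHit} s s' \<and> extended f i E P (reg s' rR) \<and>
     reg s' rHit = (if 0 < P \<and> reg s' rR = i \<and> a * P \<le> b * (i - L) then 1 else reg s rHit) \<and>
     t \<le> 7 * d + 29) s"
    unfolding block.simps(2)[of rightward]
  proof (rule wp_SeqI[OF *], elim conjE)
    fix t :: nat and s1 :: "'a state"
    assume fr: "frame {rv, rLim, rR} s s1" and "extended f i E P (reg s1 rR)" "t \<le> 7 * d + 10"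
    moreover have "const_regs a b s1" "reg s1 rN = i" "reg s1 rL = L" "reg s1 rP = P"
      using fr regs by (auto simp: frame_def const_regs_def)
    ultimately show "wp S W (block [
     If (Equal rR rN) (block [
       Arith Sub ru rN rL, Arith Mul ru rB ru, Arith Mul rv rA rP,
       If (Less ru rv) Skip (copy rHit rOne)]) Skip])
      (\<lambda>t2 s'. frame {ru, rv, rLim, rR, rHit} s s' \<and> extended f i E P (reg s' rR) \<and>
       reg s' rHit = (if 0 < P \<and> reg s' rR = i \<and> a * P \<le> b * (i - L) then 1 else reg s rHit) \<and>
       t + t2 \<le> 7 * d + 29) s1"
      using W' True by (auto simp: frame_def const_regs_def)
  qed
  then show ?thesis
    using regs True unfolding advance_def
    by (auto simp: const_regs_def simp del: block.simps elim!: wp_mono)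
qed

lemma load_item_wp:
  fixes s :: "'a state"
  assumes "const_regs a b s" "reg s rQ = q" "q + 3 < S" "q + 3 < W"
  shows "wp S W load_item (\<lambda>t s'. frame {rE, rP, rL, rR, ru} s s' \<and> reg s' rE = mem s q \<and>
    reg s' rP = mem s (q + 1) \<and> reg s' rL = mem s (q + 2) \<and> reg s' rR = mem s (q + 3) \<and> t \<le> 8) s"
  using assms by (simp add: load_item_def const_regs_def frame_def numeral_3_eq_3)

lemma store_item_wp:
  fixes s :: "'a state"
  assumes "const_regs a b s" "reg s rQ = q" "q + 3 < S" "q + 3 < W"
  shows "wp S W store_item (\<lambda>t s'. mem s' = (mem s)(q := reg s rE, q + 1 := reg s rP,
    q + 2 := reg s rL, q + 3 := reg s rR) \<and> lmem s' = lmem s \<and>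
    (\<forall>r. r \<noteq> ru \<longrightarrow> reg s' r = reg s r) \<and> t \<le> 8) s"
  using assms by (simp add: store_item_def const_regs_def numeral_3_eq_3)

lemma update_item_wp:
  fixes s :: "'a state"
  defines "m \<equiv> mem s"
  assumes regs: "const_regs a b s" "reg s rQ = q" "reg s rN = i" "reg s rS = n" "reg s rLo = lo"
      "lmem s = f"
    and inv: "item_inv a f i0 n lo (m q) (m (q + 1)) (m (q + 2)) (m (q + 3))"
    and adj: "adjacent f i0 i" "i0 \<le> M" "i \<le> M"
    and n: "1 \<le> n" "n \<le> lo" "lo + n \<le> 6 * b * n" "n \<le> i + 1"
    and q: "q + 3 < S" "q + 3 < W" and W_b: "b * (M + 2) < W"
  shows "wp S W update_item (\<lambda>t s'. \<exists>E P L r.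
     item_inv a f i n lo E P L r \<and> E = next_anchor i n (m q) \<and>
     mem s' = m(q := E, q + 1 := P, q + 2 := L, q + 3 := r) \<and> lmem s' = f \<and>
     (\<forall>r. r \<notin> {rx, rLim, ru, rv, rp, rE, rP, rL, rF, rHi, rTh, rR, rHit} \<longrightarrow> reg s' r = reg s r) \<and>
     reg s' rHit = (if 0 < P \<and> r = i \<and> a * P \<le> b * (i - L) then 1 else reg s rHit) \<and>
     t \<le> item_time i n (m q)) s"
proof -
  define d where "d = (if next_anchor i n (m q) = m q then 1 else 2 * n)"
  have I: "n dvd m q" "m q \<le> i0" "i0 < m q + 2 * n"
    using inv unfolding item_inv_def by auto
  have "i = i0 + 1 \<or> i0 = i + 1"
    using adj(1) unfolding adjacent_def by simp
  note E' = next_anchor_bounds[OF I n(1) this]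
  from load_item_wp[OF regs(1,2) q] show ?thesis
    unfolding update_item_def block.simps
  proof (rule wp_SeqI, elim conjE)
    fix t1 :: nat and s1 :: "'a state"
    assume fr1: "frame {rE, rP, rL, rR, ru} s s1" and t1: "t1 \<le> 8"
      and s1: "reg s1 rE = mem s q" "reg s1 rP = mem s (q + 1)" "reg s1 rL = mem s (q + 2)"
        "reg s1 rR = mem s (q + 3)"
    have "wp S W reanchor (\<lambda>t s'. frame {rx, rLim, ru, rv, rp, rE, rP, rL, rF, rHi, rTh, rR} s1 s' \<and>
       reg s' rE = next_anchor i n (m q) \<and> anchored a f n lo (reg s' rE) (reg s' rP) (reg s' rL) \<and>
       (0 < reg s' rP \<longrightarrow> reg s' rE \<le> reg s' rR \<and> reg s' rR \<le> i \<and>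
         matching f (reg s' rP) (reg s' rE) (reg s' rR) \<and>
         (i - reg s' rR \<le> (if reg s' rE = m q then 1 else 2 * n) \<or>
          f (reg s' rR) \<noteq> f (reg s' rR - reg s' rP))) \<and>
       t \<le> 22 + (if reg s' rE = m q then 0 else 480 * a * b * n)) s1"
      by (rule reanchor_wp[OF _ _ _ _ _ _ _ _ _ inv adj n])
        (use regs fr1 s1 in \<open>auto simp: frame_def const_regs_def m_def\<close>)
    then show "wp S W (Seq reanchor (Seq advance (Seq store_item Skip))) (\<lambda>t s'. \<exists>E P L r.
       item_inv a f i n lo E P L r \<and> E = next_anchor i n (m q) \<and>
       mem s' = m(q := E, q + 1 := P, q + 2 := L, q + 3 := r) \<and> lmem s' = f \<and>
       (\<forall>r. r \<notin> {rx, rLim, ru, rv, rp, rE, rP, rL, rF, rHi, rTh, rR, rHit} \<longrightarrow> reg s' r = reg s r) \<and>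
       reg s' rHit = (if 0 < P \<and> r = i \<and> a * P \<le> b * (i - L) then 1 else reg s rHit) \<and>
       t1 + t \<le> item_time i n (m q)) s1"
    proof (rule wp_SeqI, elim conjE)
      fix t2 :: nat and s2 :: "'a state"
      assume fr2: "frame {rx, rLim, ru, rv, rp, rE, rP, rL, rF, rHi, rTh, rR} s1 s2"
        and E: "reg s2 rE = next_anchor i n (m q)"
        and anch: "anchored a f n lo (reg s2 rE) (reg s2 rP) (reg s2 rL)"
        and P: "0 < reg s2 rP \<longrightarrow> reg s2 rE \<le> reg s2 rR \<and> reg s2 rR \<le> i \<and>
         matching f (reg s2 rP) (reg s2 rE) (reg s2 rR) \<and>
         (i - reg s2 rR \<le> (if reg s2 rE = m q then 1 else 2 * n) \<or>
          f (reg s2 rR) \<noteq> f (reg s2 rR - reg s2 rP))"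
        and t2: "t2 \<le> 22 + (if reg s2 rE = m q then 0 else 480 * a * b * n)"
      have regs2: "const_regs a b s2" "reg s2 rN = i" "lmem s2 = f" "reg s2 rQ = q" "mem s2 = m"
        using fr1 fr2 regs by (auto simp: frame_def const_regs_def m_def)
      have "wp S W advance (\<lambda>t s'. frame {ru, rv, rLim, rR, rHit} s2 s' \<and>
         extended f i (reg s2 rE) (reg s2 rP) (reg s' rR) \<and>
         reg s' rHit = (if 0 < reg s2 rP \<and> reg s' rR = i \<and> a * reg s2 rP \<le> b * (i - reg s2 rL)
           then 1 else reg s2 rHit) \<and>
         t \<le> 7 * d + 30) s2"
      proof (rule advance_wp)
        show "reg s2 rE \<le> i" "i \<le> M" "b * (M + 2) < W"
          using E E'(2) adj(3) W_b by auto
      qed (use regs2 P anch in \<open>auto simp: anchored_def d_def E\<close>)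
      then show "wp S W (Seq advance (Seq store_item Skip)) (\<lambda>t s'. \<exists>E P L r.
         item_inv a f i n lo E P L r \<and> E = next_anchor i n (m q) \<and>
         mem s' = m(q := E, q + 1 := P, q + 2 := L, q + 3 := r) \<and> lmem s' = f \<and>
         (\<forall>r. r \<notin> {rx, rLim, ru, rv, rp, rE, rP, rL, rF, rHi, rTh, rR, rHit} \<longrightarrow>
            reg s' r = reg s r) \<and>
         reg s' rHit = (if 0 < P \<and> r = i \<and> a * P \<le> b * (i - L) then 1 else reg s rHit) \<and>
         t1 + (t2 + t) \<le> item_time i n (m q)) s2"
      proof (rule wp_SeqI, elim conjE)
        fix t3 :: nat and s3 :: "'a state"
        assume fr3: "frame {ru, rv, rLim, rR, rHit} s2 s3"
          and ext: "extended f i (reg s2 rE) (reg s2 rP) (reg s3 rR)"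
          and hit: "reg s3 rHit = (if 0 < reg s2 rP \<and> reg s3 rR = i \<and>
             a * reg s2 rP \<le> b * (i - reg s2 rL) then 1 else reg s2 rHit)"
          and t3: "t3 \<le> 7 * d + 30"
        have regs3: "const_regs a b s3" "reg s3 rQ = q" "mem s3 = m" "lmem s3 = f"
          using fr3 regs2 by (auto simp: frame_def const_regs_def)
        have eq: "reg s3 rE = reg s2 rE" "reg s3 rP = reg s2 rP" "reg s3 rL = reg s2 rL"
            "reg s2 rHit = reg s rHit"
          using fr1 fr2 fr3 by (auto simp: frame_def)
        have same: "reg s3 r = reg s r"
          if "r \<notin> {rx, rLim, ru, rv, rp, rE, rP, rL, rF, rHi, rTh, rR, rHit}" for r
          using fr1 fr2 fr3 that by (simp add: frame_def)
        have inv': "item_inv a f i n lo (reg s3 rE) (reg s3 rP) (reg s3 rL) (reg s3 rR)"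
          using eq E E' anch ext unfolding item_inv_def by simp
        have time: "t1 + (t2 + (t3 + 9)) \<le> item_time i n (m q)"
          using t1 t2 t3 unfolding item_time_def d_def E by (auto simp: add_mult_distrib)
        have "wp S W store_item (\<lambda>t s'. mem s' = m(q := reg s3 rE, q + 1 := reg s3 rP,
           q + 2 := reg s3 rL, q + 3 := reg s3 rR) \<and> lmem s' = f \<and>
           (\<forall>r. r \<noteq> ru \<longrightarrow> reg s' r = reg s3 r) \<and> t \<le> 8) s3"
          using store_item_wp[OF regs3(1,2) q] unfolding regs3(3,4) .
        then show "wp S W (Seq store_item Skip) (\<lambda>t s'. \<exists>E P L r.
           item_inv a f i n lo E P L r \<and> E = next_anchor i n (m q) \<and>
           mem s' = m(q := E, q + 1 := P, q + 2 := L, q + 3 := r) \<and> lmem s' = f \<and>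
           (\<forall>r. r \<notin> {rx, rLim, ru, rv, rp, rE, rP, rL, rF, rHi, rTh, rR, rHit} \<longrightarrow>
              reg s' r = reg s r) \<and>
           reg s' rHit = (if 0 < P \<and> r = i \<and> a * P \<le> b * (i - L) then 1 else reg s rHit) \<and>
           t1 + (t2 + (t3 + t)) \<le> item_time i n (m q)) s3"
          unfolding wp_Seq wp_Skip
        proof (rule wp_mono, elim conjE)
          fix t4 :: nat and s4 :: "'a state"
          assume s4: "mem s4 = m(q := reg s3 rE, q + 1 := reg s3 rP, q + 2 := reg s3 rL, q + 3 := reg s3 rR)"
            "lmem s4 = f" "\<forall>r. r \<noteq> ru \<longrightarrow> reg s4 r = reg s3 r" "t4 \<le> 8"
          show "\<exists>E P L r.
             item_inv a f i n lo E P L r \<and> E = next_anchor i n (m q) \<and>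
             mem s4 = m(q := E, q + 1 := P, q + 2 := L, q + 3 := r) \<and> lmem s4 = f \<and>
             (\<forall>r. r \<notin> {rx, rLim, ru, rv, rp, rE, rP, rL, rF, rHi, rTh, rR, rHit} \<longrightarrow>
                reg s4 r = reg s r) \<and>
             reg s4 rHit = (if 0 < P \<and> r = i \<and> a * P \<le> b * (i - L) then 1 else reg s rHit) \<and>
             t1 + (t2 + (t3 + (t4 + 1))) \<le> item_time i n (m q)"
          proof (intro exI conjI)
            show "item_inv a f i n lo (reg s3 rE) (reg s3 rP) (reg s3 rL) (reg s3 rR)"
              by (rule inv')
            show "mem s4 = m(q := reg s3 rE, q + 1 := reg s3 rP, q + 2 := reg s3 rL, q + 3 := reg s3 rR)"
              by (rule s4(1))
            show "reg s4 rHit = (if 0 < reg s3 rP \<and> reg s3 rR = i \<and> a * reg s3 rP \<le> b * (i - reg s3 rL)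
              then 1 else reg s rHit)"
              using s4(3) hit eq by simp
            show "\<forall>r. r \<notin> {rx, rLim, ru, rv, rp, rE, rP, rL, rF, rHi, rTh, rR, rHit} \<longrightarrow>
                reg s4 r = reg s r"
              using s4(3) same by simp
          qed (use s4(2,4) eq E time in linarith)+
        qed
      qed
    qed
  qed
qed

end

section \<open>The loop over the items\<close>

definition slot_inv :: "nat \<Rightarrow> nat \<Rightarrow> (nat \<Rightarrow> 'a) \<Rightarrow> nat \<Rightarrow> (nat \<Rightarrow> nat) \<Rightarrow> nat \<Rightarrow> bool" where
  "slot_inv a b f i m q \<longleftrightarrow> item_inv a f i (size_of (3 * b) q) (low (3 * b) q)
     (m (4 * q)) (m (4 * q + 1)) (m (4 * q + 2)) (m (4 * q + 3))"

definition slot_hit :: "nat \<Rightarrow> nat \<Rightarrow> nat \<Rightarrow> (nat \<Rightarrow> nat) \<Rightarrow> nat \<Rightarrow> bool" where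
  "slot_hit a b i m q \<longleftrightarrow>
     0 < m (4 * q + 1) \<and> m (4 * q + 3) = i \<and> a * m (4 * q + 1) \<le> b * (i - m (4 * q + 2))"

text \<open>Sizes up to \<open>i + 1\<close> are visited, not just up to \<open>i\<close>: after a
  backtrack from length \<open>i + 1\<close>, an item of this size may have anchor
  \<open>i + 1\<close>, which must return to 0.\<close>

definition item_loop :: prog where
  "item_loop = While (Less rS rEnd) (block [
     update_item, Arith Add rQ rQ rFour, Arith Add rLo rLo rS, Arith Mul ru rS rK,
     If (Equal rLo ru) (Arith Add rS rS rS) Skip])"

context resources
begin

lemma W_b: "b * (M + 2) < W"
  using W(2) by (simp add: mult.assoc)

text \<open>Soundness of a hit is established item by item, whereas completeness needs all slots to
  be up to date and is drawn only after the loop. The new anchors are recorded explicitly because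
  the potential depends on them. \<open>B\<close> occurs in the time bound only, not in the
  program.\<close>

lemma item_loop_wp:
  fixes s :: "'a state"
  defines "m \<equiv> mem s"
  assumes regs: "const_regs a b s" "reg s rQ = 0" "reg s rN = i" "reg s rS = 1" "reg s rLo = 1"
      "reg s rEnd = i + 2" "reg s rHit = 0" "lmem s = f"
    and inv: "\<And>q. slot_inv a b f i0 m q"
    and adj: "adjacent f i0 i" "i0 \<le> M" "i \<le> M"
    and B: "\<And>q. size_of (3 * b) q \<le> i + 1 \<Longrightarrow> q < B"
  shows "wp S W item_loop (\<lambda>t s'.
     (\<forall>q. slot_inv a b f i (mem s') q \<and>
       mem s' (4 * q) = next_anchor i (size_of (3 * b) q) (m (4 * q))) \<and> lmem s' = f \<and>
     (reg s' rHit = 0 \<longleftrightarrow> free_upto a b f i) \<and>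
     reg s' rZero = 0 \<and> reg s' rN = i \<and> reg s' rBad = reg s rBad \<and>
     t \<le> (\<Sum>q<B. item_time i (size_of (3 * b) q) (m (4 * q)) + 8) + 1) s"
  unfolding item_loop_def
proof -
  define sz where "sz = size_of (3 * b)"
  define lo where "lo = low (3 * b)"
  let ?X = "{rx, rLim, ru, rv, rp, rE, rP, rL, rF, rHi, rTh, rR, rHit, rQ, rLo, rS}"
  have K: "2 \<le> 3 * b" using b by simp
  have fold_item: "fst (item (3 * b) q) = sz q" "snd (item (3 * b) q) = lo q" for q
    by (simp_all add: sz_def lo_def)
  note bounds = item_bounds[OF K, unfolded fold_item]
  define I where "I s' q \<longleftrightarrow> reg s' rQ = 4 * q \<and> reg s' rS = sz q \<and> reg s' rLo = lo q \<and>
      (\<forall>r. r \<notin> ?X \<longrightarrow> reg s' r = reg s r) \<and> lmem s' = f \<and>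
      (\<forall>q'<q. slot_inv a b f i (mem s') q' \<and> mem s' (4 * q') = next_anchor i (sz q') (m (4 * q')) \<and>
         (slot_hit a b i (mem s') q' \<longrightarrow> reg s' rHit = 1)) \<and>
      (\<forall>z\<ge>4 * q. mem s' z = m z) \<and> (reg s' rHit = 0 \<or> \<not> free_upto a b f i)"
    for s' :: "'a state" and q
  show "wp S W (While (Less rS rEnd) (block [
     update_item, Arith Add rQ rQ rFour, Arith Add rLo rLo rS, Arith Mul ru rS rK,
     If (Equal rLo ru) (Arith Add rS rS rS) Skip])) (\<lambda>t s'.
     (\<forall>q. slot_inv a b f i (mem s') q \<and>
       mem s' (4 * q) = next_anchor i (size_of (3 * b) q) (m (4 * q))) \<and> lmem s' = f \<and>
     (reg s' rHit = 0 \<longleftrightarrow> free_upto a b f i) \<and>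
     reg s' rZero = 0 \<and> reg s' rN = i \<and> reg s' rBad = reg s rBad \<and>
     t \<le> (\<Sum>q<B. item_time i (size_of (3 * b) q) (m (4 * q)) + 8) + 1) s"
  \<comment> \<open>The measure is the time allotted to the unvisited items, whose first index is
    recovered from the address in \<open>rQ\<close>. The 8 per item covers the passage to the next
    item and the loop test.\<close>
  proof (rule wp_While[where I = "\<lambda>s'. \<exists>q. I s' q"
        and V = "\<lambda>s'. \<Sum>q\<in>{reg s' rQ div 4..<B}. item_time i (sz q) (m (4 * q)) + 8"], goal_cases)
    case 1
    have "I s 0"
      unfolding I_def using regs by (simp add: m_def sz_def lo_def)
    then show ?case by blast
  next
    case (2 s')
    then obtain q where I: "I s' q" by blast
    have regs': "const_regs a b s'" "reg s' rN = i" "reg s' rEnd = i + 2" "reg s' rQ = 4 * q"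
        "reg s' rS = sz q" "reg s' rLo = lo q" "lmem s' = f"
      using I regs unfolding I_def const_regs_def by auto
    have "sz q \<le> i + 1"
      using 2(2) regs' by simp
    have m: "mem s' (4 * q) = m (4 * q)" "mem s' (4 * q + 1) = m (4 * q + 1)"
        "mem s' (4 * q + 2) = m (4 * q + 2)" "mem s' (4 * q + 3) = m (4 * q + 3)"
      using I unfolding I_def by auto
    have "sz q \<le> M + 1"
      using \<open>sz q \<le> i + 1\<close> adj(3) by simp
    then have "q < 3 * b * (M + 2)"
      using item_count(1)[OF K, of q "M + 1"] by (simp add: sz_def)
    then have q: "4 * q + 3 < S" "4 * q + 4 < W"
      using S W(2) by linarith+
    have qB: "q < B"
      using B \<open>sz q \<le> i + 1\<close> unfolding sz_def by blast
    have range: "lo q + sz q \<le> 6 * b * sz q" "6 * b * sz q < W" "sz q + sz q < W"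
    proof -
      show le: "lo q + sz q \<le> 6 * b * sz q"
        using bounds(3)[of q] by simp
      have "6 * b * sz q \<le> 6 * b * (M + 2)"
        using \<open>sz q \<le> M + 1\<close> by (intro mult_le_mono2) simp
      then show "6 * b * sz q < W"
        using W(2) by linarith
      show "sz q + sz q < W"
        using \<open>sz q \<le> M + 1\<close> M_le(3) by linarith
    qed
    have "wp S W update_item (\<lambda>t s'a. \<exists>E P L r.
       item_inv a f i (sz q) (lo q) E P L r \<and> E = next_anchor i (sz q) (mem s' (4 * q)) \<and>
       mem s'a = (mem s')(4 * q := E, 4 * q + 1 := P, 4 * q + 2 := L, 4 * q + 3 := r) \<and> lmem s'a = f \<and>
       (\<forall>r. r \<notin> {rx, rLim, ru, rv, rp, rE, rP, rL, rF, rHi, rTh, rR, rHit} \<longrightarrow> reg s'a r = reg s' r) \<and>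
       reg s'a rHit = (if 0 < P \<and> r = i \<and> a * P \<le> b * (i - L) then 1 else reg s' rHit) \<and>
       t \<le> item_time i (sz q) (mem s' (4 * q))) s'"
    proof (rule update_item_wp[OF regs'(1,4,2,5,6,7)])
      show "item_inv a f i0 (sz q) (lo q) (mem s' (4 * q)) (mem s' (4 * q + 1)) (mem s' (4 * q + 2))
          (mem s' (4 * q + 3))"
        using inv[of q] unfolding slot_inv_def m sz_def lo_def .
    qed (use adj bounds range q W_b \<open>sz q \<le> i + 1\<close> in auto)
    then show ?case
      unfolding block.simps
    proof (rule wp_SeqI, elim exE conjE)
      fix t :: nat and s1 :: "'a state" and E P L r
      assume inv': "item_inv a f i (sz q) (lo q) E P L r" and E: "E = next_anchor i (sz q) (mem s' (4 * q))"
        and mem: "mem s1 = (mem s')(4 * q := E, 4 * q + 1 := P, 4 * q + 2 := L, 4 * q + 3 := r)"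
        and f: "lmem s1 = f"
        and same: "\<forall>r. r \<notin> {rx, rLim, ru, rv, rp, rE, rP, rL, rF, rHi, rTh, rR, rHit} \<longrightarrow>
            reg s1 r = reg s' r"
        and hit: "reg s1 rHit = (if 0 < P \<and> r = i \<and> a * P \<le> b * (i - L) then 1 else reg s' rHit)"
        and t: "t \<le> item_time i (sz q) (mem s' (4 * q))"
      have regs1: "const_regs a b s1" "reg s1 rQ = 4 * q" "reg s1 rS = sz q" "reg s1 rLo = lo q"
        using same regs' by (simp_all add: const_regs_def)
      have new: "mem s1 (4 * q) = E" "mem s1 (4 * q + 1) = P" "mem s1 (4 * q + 2) = L"
          "mem s1 (4 * q + 3) = r"
        unfolding mem by simp_all
      have old: "mem s1 z = mem s' z" if "z < 4 * q \<or> 4 * q + 4 \<le> z" for z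
        unfolding mem using that by auto
      have slot: "slot_inv a b f i (mem s1) q" "mem s1 (4 * q) = next_anchor i (sz q) (m (4 * q))"
          "slot_hit a b i (mem s1) q \<longrightarrow> reg s1 rHit = 1"
        using inv' hit E m unfolding slot_inv_def slot_hit_def new sz_def lo_def by auto
      have unsound: "reg s1 rHit = 0 \<or> \<not> free_upto a b f i"
        using I hit item_inv_sound[OF inv'] unfolding I_def by auto
      have olds: "slot_inv a b f i (mem s1) q' \<and> mem s1 (4 * q') = next_anchor i (sz q') (m (4 * q')) \<and>
         (slot_hit a b i (mem s1) q' \<longrightarrow> reg s1 rHit = 1)" if "q' < q" for q'
      proof -
        have "mem s1 (4 * q') = mem s' (4 * q')" "mem s1 (4 * q' + 1) = mem s' (4 * q' + 1)"
          "mem s1 (4 * q' + 2) = mem s' (4 * q' + 2)" "mem s1 (4 * q' + 3) = mem s' (4 * q' + 3)"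
          using that by (auto intro!: old)
        moreover have "slot_inv a b f i (mem s') q'" "mem s' (4 * q') = next_anchor i (sz q') (m (4 * q'))"
            "slot_hit a b i (mem s') q' \<longrightarrow> reg s' rHit = 1"
          using I that unfolding I_def by auto
        ultimately show ?thesis
          using hit unfolding slot_inv_def slot_hit_def by auto
      qed
      have olds': "\<forall>q'<Suc q. slot_inv a b f i (mem s1) q' \<and>
          mem s1 (4 * q') = next_anchor i (sz q') (m (4 * q')) \<and>
         (slot_hit a b i (mem s1) q' \<longrightarrow> reg s1 rHit = 1)"
        using olds slot less_Suc_eq by auto
      have rest: "\<forall>z\<ge>4 * Suc q. mem s1 z = m z"
        using old I unfolding I_def by auto
      have succ: "I s2 (Suc q)" if "mem s2 = mem s1" "lmem s2 = f" "reg s2 rQ = 4 * Suc q"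
        "reg s2 rS = sz (Suc q)" "reg s2 rLo = lo (Suc q)" "reg s2 rHit = reg s1 rHit"
        "\<forall>r. r \<notin> ?X \<longrightarrow> reg s2 r = reg s1 r"
        for s2 :: "'a state"
        unfolding I_def that(1)
      proof (intro conjI)
        show "\<forall>r. r \<notin> ?X \<longrightarrow> reg s2 r = reg s r"
          using that(7) same I unfolding I_def by simp
      qed (use that olds' rest unsound in auto)
      have sum: "(\<Sum>q\<in>{q..<B}. item_time i (sz q) (m (4 * q)) + 8) =
          item_time i (sz q) (m (4 * q)) + 8 + (\<Sum>q\<in>{Suc q..<B}. item_time i (sz q) (m (4 * q)) + 8)"
        using qB by (rule sum.atLeast_Suc_lessThan)
      have step: "sz (Suc q) = (if lo q + sz q = sz q * (6 * b) then sz q + sz q else sz q)"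
          "lo (Suc q) = lo q + sz q"
        unfolding sz_def lo_def item_Suc by (simp_all add: mult.commute)
      have const: "reg s1 rFour = 4" "reg s1 rK = 6 * b"
        using regs1(1) by (simp_all add: const_regs_def)
      have less: "4 * q + 4 < W" "lo q + sz q < W" "sz q * (6 * b) < W" "sz q + sz q < W"
        using q range by (simp_all add: mult.commute)
      have "wp S W (block [Arith Add rQ rQ rFour, Arith Add rLo rLo rS, Arith Mul ru rS rK,
            If (Equal rLo ru) (Arith Add rS rS rS) Skip])
          (\<lambda>t s2. mem s2 = mem s1 \<and> lmem s2 = f \<and> reg s2 rQ = 4 * Suc q \<and>
             reg s2 rS = sz (Suc q) \<and> reg s2 rLo = lo (Suc q) \<and> reg s2 rHit = reg s1 rHit \<and>
             (\<forall>r. r \<notin> ?X \<longrightarrow> reg s2 r = reg s1 r) \<and> t \<le> 6) s1"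
        unfolding step using less regs1(2-4) const f by simp
      then show "wp S W (Seq (Arith Add rQ rQ rFour) (Seq (Arith Add rLo rLo rS)
          (Seq (Arith Mul ru rS rK) (Seq (If (Equal rLo ru) (Arith Add rS rS rS) Skip) Skip))))
         (\<lambda>t2 s'a. (\<exists>q. I s'a q) \<and>
           t + t2 + 1 + (\<Sum>q\<in>{reg s'a rQ div 4..<B}. item_time i (sz q) (m (4 * q)) + 8)
             \<le> (\<Sum>q\<in>{reg s' rQ div 4..<B}. item_time i (sz q) (m (4 * q)) + 8)) s1"
        unfolding block.simps
      proof (rule wp_mono, elim conjE)
        fix t2 :: nat and s2 :: "'a state"
        assume s2: "mem s2 = mem s1" "lmem s2 = f" "reg s2 rQ = 4 * Suc q"
          "reg s2 rS = sz (Suc q)" "reg s2 rLo = lo (Suc q)" "reg s2 rHit = reg s1 rHit"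
          "\<forall>r. r \<notin> ?X \<longrightarrow> reg s2 r = reg s1 r" "t2 \<le> 6"
        have "reg s2 rQ div 4 = Suc q" "reg s' rQ div 4 = q"
          using s2(3) regs'(4) by simp_all
        then show "(\<exists>q. I s2 q) \<and>
           t + t2 + 1 + (\<Sum>q\<in>{reg s2 rQ div 4..<B}. item_time i (sz q) (m (4 * q)) + 8)
             \<le> (\<Sum>q\<in>{reg s' rQ div 4..<B}. item_time i (sz q) (m (4 * q)) + 8)"
          using succ[OF s2(1-7)] t s2(8) sum m(1) by auto
      qed
    qed
  next
    case (3 t s')
    then obtain q where I: "I s' q" by blast
    have end_: "i + 2 \<le> sz q"
      using 3(2) I regs(6) unfolding I_def by simp
    have large: "i + 1 < sz q'" if "q \<le> q'" for q'
      using item_mono[of "3 * b" q "q' - q"] that end_ unfolding sz_def by simp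
    \<comment> \<open>The unvisited items are larger than \<open>i + 1\<close>; their anchor is 0,
      and \<open>next_anchor\<close> keeps it there.\<close>
    have slots: "slot_inv a b f i (mem s') q' \<and> mem s' (4 * q') = next_anchor i (sz q') (m (4 * q'))"
      for q'
    proof (cases "q' < q")
      case True
      then show ?thesis
        using I unfolding I_def by blast
    next
      case False
      then have eq: "mem s' (4 * q') = m (4 * q')" "mem s' (4 * q' + 1) = m (4 * q' + 1)"
          "mem s' (4 * q' + 2) = m (4 * q' + 2)" "mem s' (4 * q' + 3) = m (4 * q' + 3)"
        using I unfolding I_def by auto
      have "i0 \<le> i + 1"
        using adj(1) unfolding adjacent_def by auto
      moreover have "1 \<le> lo q'"
        using bounds(1,2)[of q'] by simp
      ultimately show ?thesis
        using item_inv_idle[OF inv[of q', unfolded slot_inv_def], of i] large[of q'] False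
        unfolding slot_inv_def eq sz_def lo_def by (auto simp: next_anchor_def)
    qed
    \<comment> \<open>If the current text is not free, the shorter of the two adjacent texts must be
      the previous one, of length \<open>i - 1\<close>.\<close>
    have "free_upto a b f i" if "reg s' rHit = 0"
    proof (rule ccontr)
      assume nf: "\<not> free_upto a b f i"
      then have "free_upto a b f (i - 1)"
        using adj(1) unfolding adjacent_def by (auto simp: min_def split: if_splits)
      from item_inv_complete[OF a b slots[THEN conjunct1, unfolded slot_inv_def] this nf]
      obtain q' where q': "size_of (3 * b) q' \<le> i" "slot_hit a b i (mem s') q'"
        unfolding slot_hit_def by blast
      then have "q' < q"
        using large[of q'] unfolding sz_def by (meson leD le_trans less_imp_le not_le_imp_less le_add1)
      with q'(2) I that show False
        unfolding I_def by auto
    qed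
    moreover have "t \<le> (\<Sum>q<B. item_time i (sz q) (m (4 * q)) + 8) + 1"
      using 3(3) regs(2) by (simp add: atLeast0LessThan)
    ultimately show ?case
      using slots I regs unfolding I_def fold_item const_regs_def by auto
  qed
qed

end

section \<open>The algorithm\<close>

definition setup_regs :: "nat \<Rightarrow> nat \<Rightarrow> prog" where
  "setup_regs a b = block [Const rZero 0, Const rOne 1, Const rA a, Const rB b, Const rK (6 * b),
     Const rFour 4]"

definition start_loop :: prog where
  "start_loop = block [copy rHit rZero, copy rS rOne, copy rLo rOne, copy rQ rZero,
     Arith Add rEnd rN rOne, Arith Add rEnd rEnd rOne]"

definition check_text :: prog where
  "check_text = block [
     If (Equal rBad rZero) (block [
       start_loop, item_loop,
       If (Equal rHit rZero) Skip (copy rBad rN)]) Skip,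
     If (Equal rBad rZero) (Const 0 1) (Const 0 0)]"

definition detector :: "nat \<Rightarrow> nat \<Rightarrow> prog \<times> prog" where
  "detector a b =
    (block [setup_regs a b, Store_Letter rN 0, Arith Add rN rN rOne, check_text],
     block [setup_regs a b, Arith Sub rN rN rOne, If (Less rN rBad) (copy rBad rZero) Skip,
       check_text])"

section \<open>Amortized analysis\<close>

text \<open>At most one of the truncated differences is nonzero, so this is the distance between
  \<open>i\<close> and \<open>E + n\<close>, except that it vanishes for \<open>E = 0\<close> and
  \<open>i < n\<close>. An anchor 0 never moves left and needs no savings there, and all items
  together start with potential 0.\<close>

definition potential :: "nat \<Rightarrow> nat \<Rightarrow> nat \<Rightarrow> nat" where
  "potential i n E = (i - (E + n)) + (if 0 < E then E + n - i else 0)"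

text \<open>The length up to which the items have processed the text: once a repetition has been
  found, the items rest until it is removed.\<close>

definition processed :: "'a state \<Rightarrow> nat" where
  "processed s = (if reg s rBad = 0 then reg s rN else reg s rBad)"

context resources
begin

definition rate :: nat where
  "rate = 480 * a * b + 14"

definition total_potential :: "nat \<Rightarrow> 'a state \<Rightarrow> nat" where
  "total_potential B s =
     rate * (\<Sum>q<B. potential (processed s) (size_of (3 * b) q) (mem s (4 * q)))"

definition text_inv :: "'a list \<Rightarrow> 'a state \<Rightarrow> bool" where
  "text_inv w s \<longleftrightarrow> reg s rN = length w \<and> (\<forall>x<length w. lmem s x = w ! x) \<and>
     reg s rBad \<le> length w \<and> (\<forall>q. slot_inv a b (lmem s) (processed s) (mem s) q) \<and>
     (if reg s rBad = 0 then free_upto a b (lmem s) (length w)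
      else \<not> free_upto a b (lmem s) (reg s rBad) \<and> free_upto a b (lmem s) (reg s rBad - 1))"

text \<open>Before a move the length is at an end of the window, with potential at least
  \<open>n - 1\<close>; after it the potential is at most 1. Without a move the potential grows by
  at most 1. Therefore 2 units per operation suffice, and \<open>rate\<close> converts a unit into
  the cost of a move per position.\<close>

lemma item_time_amortized:
  assumes "n dvd E" "E \<le> i0" "i0 < E + 2 * n" "1 \<le> n" "i = i0 + 1 \<or> i0 = i + 1"
  shows "item_time i n E + rate * potential i n (next_anchor i n E)
    \<le> rate * potential i0 n E + (100 + 2 * rate)"
proof -
  note E' = next_anchor_bounds[OF assms]
  have "(if next_anchor i n E = E then 0 else n) + potential i n (next_anchor i n E)
      \<le> potential i0 n E + 2"
    using assms(2-5) E'(2,6) unfolding potential_def next_anchor_def by (auto split: if_splits)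
  then have "rate * ((if next_anchor i n E = E then 0 else n) + potential i n (next_anchor i n E))
      \<le> rate * (potential i0 n E + 2)"
    by (rule mult_le_mono2)
  then show ?thesis
    unfolding item_time_def rate_def[symmetric] by (auto simp: algebra_simps)
qed

lemma check_text_wp:
  fixes s :: "'a state"
  assumes regs: "const_regs a b s" "reg s rN = i" "lmem s = f"
    and bad: "reg s rBad = 0 \<Longrightarrow> adjacent f i0 i \<and> i0 \<le> M \<and> (\<forall>q. slot_inv a b f i0 (mem s) q)"
    and i: "i \<le> M"
    and B: "\<And>q. size_of (3 * b) q \<le> i + 1 \<Longrightarrow> q < B"
  shows "wp S W check_text (\<lambda>t s'. lmem s' = f \<and> reg s' rN = i \<and>
     (if reg s rBad = 0 then
        (\<forall>q. slot_inv a b f i (mem s') q) \<and> reg s' rBad = (if free_upto a b f i then 0 else i) \<and>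
        t + rate * (\<Sum>q<B. potential i (size_of (3 * b) q) (mem s' (4 * q)))
          \<le> rate * (\<Sum>q<B. potential i0 (size_of (3 * b) q) (mem s (4 * q)))
            + (108 + 2 * rate) * B + 20
      else mem s' = mem s \<and> reg s' rBad = reg s rBad \<and> t \<le> 20) \<and>
     (reg s' 0 \<noteq> 0 \<longleftrightarrow> reg s' rBad = 0)) s"
proof (cases "reg s rBad = 0")
  case False
  then show ?thesis
    using regs M_le(3) by (simp add: check_text_def const_regs_def)
next
  case True
  note bad = bad[OF True]
  define s1 where "s1 = s\<lparr>reg := (reg s)(rHit := 0, rS := 1, rLo := 1, rQ := 0, rEnd := i + 2)\<rparr>"
  let ?post = "\<lambda>s'. (\<forall>q. slot_inv a b f i (mem s') q \<and>
       mem s' (4 * q) = next_anchor i (size_of (3 * b) q) (mem s (4 * q))) \<and> lmem s' = f \<and>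
     (reg s' rHit = 0 \<longleftrightarrow> free_upto a b f i) \<and>
     reg s' rZero = 0 \<and> reg s' rN = i \<and> reg s' rBad = 0"
  let ?time = "\<Sum>q<B. item_time i (size_of (3 * b) q) (mem s (4 * q)) + 8"
  have "wp S W item_loop (\<lambda>t s'.
     (\<forall>q. slot_inv a b f i (mem s') q \<and>
       mem s' (4 * q) = next_anchor i (size_of (3 * b) q) (mem s1 (4 * q))) \<and> lmem s' = f \<and>
     (reg s' rHit = 0 \<longleftrightarrow> free_upto a b f i) \<and>
     reg s' rZero = 0 \<and> reg s' rN = i \<and> reg s' rBad = reg s1 rBad \<and>
     t \<le> (\<Sum>q<B. item_time i (size_of (3 * b) q) (mem s1 (4 * q)) + 8) + 1) s1"
    by (rule item_loop_wp[where ?i0.0 = i0])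
      (use regs bad i B in \<open>auto simp: s1_def const_regs_def\<close>)
  then have loop: "wp S W item_loop (\<lambda>t s'. ?post s' \<and> t \<le> ?time + 1) s1"
    using True by (simp add: s1_def)
  have sum: "?time + rate * (\<Sum>q<B. potential i (size_of (3 * b) q) (mem s' (4 * q)))
      \<le> rate * (\<Sum>q<B. potential i0 (size_of (3 * b) q) (mem s (4 * q))) + (108 + 2 * rate) * B"
    if "?post s'" for s' :: "'a state"
  proof -
    have "?time + rate * (\<Sum>q<B. potential i (size_of (3 * b) q) (mem s' (4 * q))) =
        (\<Sum>q<B. item_time i (size_of (3 * b) q) (mem s (4 * q)) + 8 +
          rate * potential i (size_of (3 * b) q) (mem s' (4 * q)))"
      by (simp only: sum.distrib sum_distrib_left)
    \<comment> \<open>The 108 is the constant 100 of \<open>item_time\<close> plus the 8 steps of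
      the loop over the items; \<open>2 * rate\<close> is the amortized allowance.\<close>
    also have "\<dots> \<le> (\<Sum>q<B. rate * potential i0 (size_of (3 * b) q) (mem s (4 * q)) + (108 + 2 * rate))"
    proof (rule sum_mono)
      fix q
      have "item_inv a f i0 (size_of (3 * b) q) (low (3 * b) q) (mem s (4 * q)) (mem s (4 * q + 1))
          (mem s (4 * q + 2)) (mem s (4 * q + 3))"
        using bad unfolding slot_inv_def by blast
      then have "size_of (3 * b) q dvd mem s (4 * q)" "mem s (4 * q) \<le> i0"
          "i0 < mem s (4 * q) + 2 * size_of (3 * b) q"
        unfolding item_inv_def by auto
      moreover have "1 \<le> size_of (3 * b) q"
        using b by (intro item_bounds(1)) simp
      moreover have "i = i0 + 1 \<or> i0 = i + 1"
        using bad unfolding adjacent_def by blast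
      moreover have "mem s' (4 * q) = next_anchor i (size_of (3 * b) q) (mem s (4 * q))"
        using that by blast
      ultimately show "item_time i (size_of (3 * b) q) (mem s (4 * q)) + 8 +
          rate * potential i (size_of (3 * b) q) (mem s' (4 * q))
          \<le> rate * potential i0 (size_of (3 * b) q) (mem s (4 * q)) + (108 + 2 * rate)"
        using item_time_amortized[of "size_of (3 * b) q" "mem s (4 * q)" i0 i] by simp
    qed
    also have "\<dots> = rate * (\<Sum>q<B. potential i0 (size_of (3 * b) q) (mem s (4 * q))) + (108 + 2 * rate) * B"
      by (simp add: sum.distrib sum_distrib_left)
    finally show ?thesis .
  qed
  have W': "0 < W" "1 < W" "i + 1 < W" "i + 2 < W"
    using M_le(3) i by linarith+
  have "wp S W (block [item_loop, If (Equal rHit rZero) Skip (copy rBad rN)])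
      (\<lambda>t s'. (\<forall>q. slot_inv a b f i (mem s') q) \<and> lmem s' = f \<and> reg s' rN = i \<and> reg s' rZero = 0 \<and>
        reg s' rBad = (if free_upto a b f i then 0 else i) \<and>
        t + rate * (\<Sum>q<B. potential i (size_of (3 * b) q) (mem s' (4 * q)))
          \<le> rate * (\<Sum>q<B. potential i0 (size_of (3 * b) q) (mem s (4 * q)))
            + (108 + 2 * rate) * B + 4) s1"
    unfolding block.simps
  proof (rule wp_SeqI[OF loop], elim conjE)
    fix t :: nat and s2 :: "'a state"
    assume s2: "\<forall>q. slot_inv a b f i (mem s2) q \<and>
       mem s2 (4 * q) = next_anchor i (size_of (3 * b) q) (mem s (4 * q))" "lmem s2 = f"
     "reg s2 rHit = 0 \<longleftrightarrow> free_upto a b f i"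
     "reg s2 rZero = 0" "reg s2 rN = i" "reg s2 rBad = 0" "t \<le> ?time + 1"
    have "?time + rate * (\<Sum>q<B. potential i (size_of (3 * b) q) (mem s2 (4 * q)))
        \<le> rate * (\<Sum>q<B. potential i0 (size_of (3 * b) q) (mem s (4 * q))) + (108 + 2 * rate) * B"
      by (rule sum) (use s2 in blast)
    then have "t + rate * (\<Sum>q<B. potential i (size_of (3 * b) q) (mem s2 (4 * q)))
          \<le> rate * (\<Sum>q<B. potential i0 (size_of (3 * b) q) (mem s (4 * q)))
            + (108 + 2 * rate) * B + 1"
      using s2(7) by linarith
    then show "wp S W (Seq (If (Equal rHit rZero) Skip (copy rBad rN)) Skip)
      (\<lambda>t2 s'. (\<forall>q. slot_inv a b f i (mem s') q) \<and> lmem s' = f \<and> reg s' rN = i \<and> reg s' rZero = 0 \<and>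
        reg s' rBad = (if free_upto a b f i then 0 else i) \<and>
        t + t2 + rate * (\<Sum>q<B. potential i (size_of (3 * b) q) (mem s' (4 * q)))
          \<le> rate * (\<Sum>q<B. potential i0 (size_of (3 * b) q) (mem s (4 * q)))
            + (108 + 2 * rate) * B + 4) s2"
      using s2(1-6) W' by (cases "free_upto a b f i") auto
  qed
  note loop = this
  have "wp S W start_loop (\<lambda>t s'. s' = s1 \<and> t = 7) s"
    using regs W' unfolding s1_def start_loop_def by (simp add: const_regs_def)
  then have init: "wp S W (block [start_loop, item_loop, If (Equal rHit rZero) Skip (copy rBad rN)])
     (\<lambda>t s'. (\<forall>q. slot_inv a b f i (mem s') q) \<and> lmem s' = f \<and> reg s' rN = i \<and> reg s' rZero = 0 \<and>
        reg s' rBad = (if free_upto a b f i then 0 else i) \<and>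
        t + rate * (\<Sum>q<B. potential i (size_of (3 * b) q) (mem s' (4 * q)))
          \<le> rate * (\<Sum>q<B. potential i0 (size_of (3 * b) q) (mem s (4 * q)))
            + (108 + 2 * rate) * B + 12) s"
    unfolding block.simps(2)[of start_loop]
  proof (rule wp_SeqI, elim conjE)
    fix t :: nat and s' :: "'a state" assume "s' = s1" "t = 7"
    then show "wp S W (block [item_loop, If (Equal rHit rZero) Skip (copy rBad rN)])
     (\<lambda>t2 s'. (\<forall>q. slot_inv a b f i (mem s') q) \<and> lmem s' = f \<and> reg s' rN = i \<and> reg s' rZero = 0 \<and>
        reg s' rBad = (if free_upto a b f i then 0 else i) \<and>
        t + t2 + rate * (\<Sum>q<B. potential i (size_of (3 * b) q) (mem s' (4 * q)))
          \<le> rate * (\<Sum>q<B. potential i0 (size_of (3 * b) q) (mem s (4 * q)))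
            + (108 + 2 * rate) * B + 12) s'"
      by (simp only:) (rule wp_mono[OF loop], elim conjE, intro conjI; linarith?)
  qed
  show ?thesis
    unfolding check_text_def block.simps(2)[of "If _ _ _"]
  proof (rule wp_SeqI[where R = "\<lambda>t s'. (\<forall>q. slot_inv a b f i (mem s') q) \<and> lmem s' = f \<and>
        reg s' rN = i \<and> reg s' rZero = 0 \<and> reg s' rBad = (if free_upto a b f i then 0 else i) \<and>
        t + rate * (\<Sum>q<B. potential i (size_of (3 * b) q) (mem s' (4 * q)))
          \<le> rate * (\<Sum>q<B. potential i0 (size_of (3 * b) q) (mem s (4 * q)))
            + (108 + 2 * rate) * B + 13"], goal_cases)
    case 1
    have "holds (Equal rBad rZero) s"
      using True regs by (simp add: const_regs_def)
    then show ?case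
      unfolding wp_If by (simp only: if_True) (rule wp_mono[OF init], auto)
  next
    case (2 t1 s2)
    then show ?case
      using True W' by auto
  qed
qed


lemma setup_regs_wp:
  fixes s :: "'a state"
  shows "wp S W (setup_regs a b) (\<lambda>t s'. const_regs a b s' \<and> mem s' = mem s \<and> lmem s' = lmem s \<and>
    lreg s' = lreg s \<and> reg s' rN = reg s rN \<and> reg s' rBad = reg s rBad \<and> t \<le> 7) s"
proof -
  have "a * 1 \<le> a * (M + 2)" "b * 1 \<le> b * (M + 2)"
    by (intro mult_le_mono2; simp)+
  then have "a < W" "6 * b < W" "4 < W" "b < W"
    using W by linarith+
  then show ?thesis
    by (simp add: setup_regs_def const_regs_def)
qed

lemma slot_inv_cong:
  assumes "slot_inv a b f i m q" "\<And>z. z < i \<Longrightarrow> f z = g z"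
  shows "slot_inv a b g i m q"
  using item_inv_cong[OF assms(1)[unfolded slot_inv_def] assms(2)] unfolding slot_inv_def .

lemma text_inv_free:
  assumes "text_inv w s"
  shows "reg s rBad = 0 \<longleftrightarrow> free_upto a b (\<lambda>x. w ! x) (length w)"
proof -
  have "free_upto a b (\<lambda>x. w ! x) (length w) = free_upto a b (lmem s) (length w)"
    by (rule free_upto_cong) (use assms in \<open>simp add: text_inv_def\<close>)
  moreover have "\<not> free_upto a b (lmem s) (length w)" if "reg s rBad \<noteq> 0"
    using assms that free_upto_mono[of a b "lmem s" "length w" "reg s rBad"]
    unfolding text_inv_def by auto
  ultimately show ?thesis
    using assms unfolding text_inv_def by auto
qed

text \<open>If the text already contains a repetition, the new letter lies after the prefix of
  length \<open>rBad\<close>, and slots and potential stay as they are. Otherwise the slots describe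
  the old text, which is one letter shorter and free.\<close>

lemma read_wp:
  fixes s :: "'a state"
  assumes inv: "text_inv w s" and len: "length w < M"
    and B: "\<And>q. size_of (3 * b) q \<le> M + 1 \<Longrightarrow> q < B"
  shows "wp S W (fst (detector a b)) (\<lambda>t s'. text_inv (w @ [x]) s' \<and>
     (reg s' 0 \<noteq> 0 \<longleftrightarrow> reg s' rBad = 0) \<and>
     t + total_potential B s' \<le> total_potential B s + ((108 + 2 * rate) * B + 40))
     (s\<lparr>lreg := (lreg s)(0 := x)\<rparr>)"
proof -
  define f where "f = (lmem s)(length w := x)"
  define i where "i = length w + 1"
  have f: "z < length w \<Longrightarrow> lmem s z = f z" for z
    by (simp add: f_def)
  have letters: "\<forall>z<length (w @ [x]). f z = (w @ [x]) ! z"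
    using inv by (auto simp: f_def text_inv_def nth_append less_Suc_eq)
  have "i < W" "length w < S"
    using len M_le by (auto simp: i_def)
  then have "wp S W (block [setup_regs a b, Store_Letter rN 0, Arith Add rN rN rOne])
     (\<lambda>t s'. const_regs a b s' \<and> mem s' = mem s \<and> lmem s' = f \<and> reg s' rN = i \<and>
        reg s' rBad = reg s rBad \<and> t \<le> 10) (s\<lparr>lreg := (lreg s)(0 := x)\<rparr>)"
    unfolding block.simps using inv
    by (intro wp_SeqI[OF setup_regs_wp]) (auto simp: const_regs_def text_inv_def f_def i_def)
  then have prep: "wp S W (setup_regs a b) (\<lambda>t1. wp S W (Store_Letter rN 0)
     (\<lambda>t2. wp S W (Arith Add rN rN rOne)
     (\<lambda>t3 s'. const_regs a b s' \<and> mem s' = mem s \<and> lmem s' = f \<and> reg s' rN = i \<and>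
        reg s' rBad = reg s rBad \<and> t1 + (t2 + (t3 + 1)) \<le> 10))) (s\<lparr>lreg := (lreg s)(0 := x)\<rparr>)"
    by (simp only: block.simps wp_Seq wp_Skip)
  show ?thesis
    unfolding detector_def fst_conv block.simps wp_Seq wp_Skip
  proof (rule wp_mono[OF prep], (erule wp_mono)+, elim conjE)
    fix t1 t2 t3 :: nat and s1 :: "'a state"
    assume s1: "const_regs a b s1" "mem s1 = mem s" "lmem s1 = f" "reg s1 rN = i"
      "reg s1 rBad = reg s rBad" "t1 + (t2 + (t3 + 1)) \<le> 10"
    have bad: "adjacent f (length w) i \<and> length w \<le> M \<and> (\<forall>q. slot_inv a b f (length w) (mem s1) q)"
      if "reg s1 rBad = 0"
    proof -
      have "free_upto a b f (length w)"
        using inv that s1(5) free_upto_cong[of "length w" "lmem s" f a b] f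
        unfolding text_inv_def by simp
      moreover have "slot_inv a b f (length w) (mem s1) q" for q
      proof -
        have "processed s = length w"
          using inv that s1(5) unfolding text_inv_def processed_def by simp
        then have "slot_inv a b (lmem s) (length w) (mem s) q"
          using inv unfolding text_inv_def by metis
        then show ?thesis
          unfolding s1(2) using f by (rule slot_inv_cong)
      qed
      ultimately show ?thesis
        using len unfolding adjacent_def i_def by simp
    qed
    have "wp S W check_text (\<lambda>t s'. lmem s' = f \<and> reg s' rN = i \<and>
     (if reg s1 rBad = 0 then
        (\<forall>q. slot_inv a b f i (mem s') q) \<and> reg s' rBad = (if free_upto a b f i then 0 else i) \<and>
        t + rate * (\<Sum>q<B. potential i (size_of (3 * b) q) (mem s' (4 * q)))
          \<le> rate * (\<Sum>q<B. potential (length w) (size_of (3 * b) q) (mem s1 (4 * q)))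
            + (108 + 2 * rate) * B + 20
      else mem s' = mem s1 \<and> reg s' rBad = reg s1 rBad \<and> t \<le> 20) \<and>
     (reg s' 0 \<noteq> 0 \<longleftrightarrow> reg s' rBad = 0)) s1"
      by (rule check_text_wp[OF s1(1,4,3) bad]) (use len B in \<open>auto simp: i_def\<close>)
    then show "wp S W check_text (\<lambda>t4 s'. text_inv (w @ [x]) s' \<and>
     (reg s' 0 \<noteq> 0 \<longleftrightarrow> reg s' rBad = 0) \<and>
     t1 + (t2 + (t3 + (t4 + 1))) + total_potential B s'
       \<le> total_potential B s + ((108 + 2 * rate) * B + 40)) s1"
    proof (rule wp_mono, elim conjE)
      fix t4 :: nat and s' :: "'a state"
      assume s': "lmem s' = f" "reg s' rN = i" "reg s' 0 \<noteq> 0 \<longleftrightarrow> reg s' rBad = 0"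
        and c: "if reg s1 rBad = 0 then
        (\<forall>q. slot_inv a b f i (mem s') q) \<and> reg s' rBad = (if free_upto a b f i then 0 else i) \<and>
        t4 + rate * (\<Sum>q<B. potential i (size_of (3 * b) q) (mem s' (4 * q)))
          \<le> rate * (\<Sum>q<B. potential (length w) (size_of (3 * b) q) (mem s1 (4 * q)))
            + (108 + 2 * rate) * B + 20
        else mem s' = mem s1 \<and> reg s' rBad = reg s1 rBad \<and> t4 \<le> 20"
      show "text_inv (w @ [x]) s' \<and> (reg s' 0 \<noteq> 0 \<longleftrightarrow> reg s' rBad = 0) \<and>
        t1 + (t2 + (t3 + (t4 + 1))) + total_potential B s'
          \<le> total_potential B s + ((108 + 2 * rate) * B + 40)"
      proof (cases "reg s rBad = 0")
        case True
        have p: "processed s' = i" "processed s = length w"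
          using c True s1(5) s'(2) inv by (auto simp: processed_def text_inv_def)
        have "free_upto a b f (length w)"
          using bad True s1(5) unfolding adjacent_def i_def by simp
        then have "text_inv (w @ [x]) s'"
          using c True s1(5) s' letters p unfolding text_inv_def by (auto simp: i_def)
        moreover have "t4 + total_potential B s' \<le> total_potential B s + (108 + 2 * rate) * B + 20"
          using c True s1(2,5) unfolding total_potential_def p by simp
        ultimately show ?thesis
          using s1(6) s'(3) by linarith
      next
        case False
        with c s1 have c: "mem s' = mem s" "reg s' rBad = reg s rBad" "t4 \<le> 20"
          by auto
        have p: "processed s' = reg s rBad" "processed s = reg s rBad"
          using False c(2) by (auto simp: processed_def)
        have "reg s rBad \<le> length w"
          using inv by (simp add: text_inv_def)
        then have "slot_inv a b f (reg s rBad) (mem s) q" for q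
          using inv slot_inv_cong[of "lmem s" "reg s rBad" "mem s" q f] f p(2)
          unfolding text_inv_def by simp
        moreover have "free_upto a b f (reg s rBad) = free_upto a b (lmem s) (reg s rBad)"
            "free_upto a b f (reg s rBad - 1) = free_upto a b (lmem s) (reg s rBad - 1)"
          using f \<open>reg s rBad \<le> length w\<close> by (auto intro!: free_upto_cong)
        ultimately have "text_inv (w @ [x]) s'"
          using inv c s' letters p False \<open>reg s rBad \<le> length w\<close> unfolding text_inv_def
          by (auto simp: i_def)
        moreover have "total_potential B s' = total_potential B s"
          unfolding total_potential_def p c(1) ..
        ultimately show ?thesis
          using s1(6) s'(3) c(3) by linarith
      qed
    qed
  qed
qed

text \<open>The items wake exactly when the deleted letter was the last one of the shortest prefix
  with a repetition. At that moment \<open>processed s\<close> is the old length, so no operation is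
  missing from the view of the items, and the remaining text is free.\<close>

lemma backtrack_wp:
  fixes s :: "'a state"
  assumes inv: "text_inv w s" and len: "length w \<le> M" and w: "w \<noteq> []"
    and B: "\<And>q. size_of (3 * b) q \<le> M + 1 \<Longrightarrow> q < B"
  shows "wp S W (snd (detector a b)) (\<lambda>t s'. text_inv (butlast w) s' \<and>
     (reg s' 0 \<noteq> 0 \<longleftrightarrow> reg s' rBad = 0) \<and>
     t + total_potential B s' \<le> total_potential B s + ((108 + 2 * rate) * B + 40)) s"
proof -
  define f where "f = lmem s"
  define i where "i = length w - 1"
  define bad where "bad = (if i < reg s rBad then 0 else reg s rBad)"
  have lw: "length w = i + 1"
    using w unfolding i_def by (cases w) auto
  have letters: "\<forall>z<length (butlast w). f z = butlast w ! z"
    using inv by (auto simp: f_def text_inv_def nth_butlast)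
  have "i < W"
    using len lw M_le(3) by simp
  then have "wp S W (block [setup_regs a b, Arith Sub rN rN rOne, If (Less rN rBad) (copy rBad rZero) Skip])
     (\<lambda>t s'. const_regs a b s' \<and> mem s' = mem s \<and> lmem s' = f \<and> reg s' rN = i \<and>
        reg s' rBad = bad \<and> t \<le> 11) s"
    unfolding block.simps using inv
    by (intro wp_SeqI[OF setup_regs_wp]) (auto simp: const_regs_def text_inv_def f_def i_def bad_def)
  then have prep: "wp S W (setup_regs a b) (\<lambda>t1. wp S W (Arith Sub rN rN rOne)
     (\<lambda>t2. wp S W (If (Less rN rBad) (copy rBad rZero) Skip)
     (\<lambda>t3 s'. const_regs a b s' \<and> mem s' = mem s \<and> lmem s' = f \<and> reg s' rN = i \<and>
        reg s' rBad = bad \<and> t1 + (t2 + (t3 + 1)) \<le> 11))) s"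
    by (simp only: block.simps wp_Seq wp_Skip)
  show ?thesis
    unfolding detector_def snd_conv block.simps(2)[of "setup_regs a b"]
      block.simps(2)[of "Arith Sub rN rN rOne"]
      block.simps(2)[of "If (Less rN rBad) (copy rBad rZero) Skip"]
      block.simps(2)[of check_text] block.simps(1) wp_Seq wp_Skip
  proof (rule wp_mono[OF prep], (erule wp_mono)+, elim conjE)
    fix t1 t2 t3 :: nat and s1 :: "'a state"
    assume s1: "const_regs a b s1" "mem s1 = mem s" "lmem s1 = f" "reg s1 rN = i"
      "reg s1 rBad = bad" "t1 + (t2 + (t3 + 1)) \<le> 11"
    have awake: "processed s = length w \<and> free_upto a b f i" if "bad = 0"
    proof (cases "reg s rBad = 0")
      case True
      then show ?thesis
        using inv lw free_upto_mono[of a b f "length w" i]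
        unfolding text_inv_def processed_def f_def by auto
    next
      case False
      then have "reg s rBad = length w"
        using inv that lw unfolding text_inv_def bad_def by (auto split: if_splits)
      then show ?thesis
        using inv lw unfolding text_inv_def processed_def f_def by auto
    qed
    have pre: "adjacent f (length w) i \<and> length w \<le> M \<and> (\<forall>q. slot_inv a b f (length w) (mem s1) q)"
      if "reg s1 rBad = 0"
      using awake that s1(2,5) inv len lw unfolding adjacent_def text_inv_def f_def by auto
    have "wp S W check_text (\<lambda>t s'. lmem s' = f \<and> reg s' rN = i \<and>
     (if reg s1 rBad = 0 then
        (\<forall>q. slot_inv a b f i (mem s') q) \<and> reg s' rBad = (if free_upto a b f i then 0 else i) \<and>
        t + rate * (\<Sum>q<B. potential i (size_of (3 * b) q) (mem s' (4 * q)))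
          \<le> rate * (\<Sum>q<B. potential (length w) (size_of (3 * b) q) (mem s1 (4 * q)))
            + (108 + 2 * rate) * B + 20
      else mem s' = mem s1 \<and> reg s' rBad = reg s1 rBad \<and> t \<le> 20) \<and>
     (reg s' 0 \<noteq> 0 \<longleftrightarrow> reg s' rBad = 0)) s1"
      by (rule check_text_wp[OF s1(1,4,3) pre]) (use len lw B in auto)
    then show "wp S W check_text (\<lambda>t4 s'. text_inv (butlast w) s' \<and>
     (reg s' 0 \<noteq> 0 \<longleftrightarrow> reg s' rBad = 0) \<and>
     t1 + (t2 + (t3 + (t4 + 1))) + total_potential B s'
       \<le> total_potential B s + ((108 + 2 * rate) * B + 40)) s1"
    proof (rule wp_mono, elim conjE)
      fix t4 :: nat and s' :: "'a state"
      assume s': "lmem s' = f" "reg s' rN = i" "reg s' 0 \<noteq> 0 \<longleftrightarrow> reg s' rBad = 0"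
        and c: "if reg s1 rBad = 0 then
        (\<forall>q. slot_inv a b f i (mem s') q) \<and> reg s' rBad = (if free_upto a b f i then 0 else i) \<and>
        t4 + rate * (\<Sum>q<B. potential i (size_of (3 * b) q) (mem s' (4 * q)))
          \<le> rate * (\<Sum>q<B. potential (length w) (size_of (3 * b) q) (mem s1 (4 * q)))
            + (108 + 2 * rate) * B + 20
        else mem s' = mem s1 \<and> reg s' rBad = reg s1 rBad \<and> t4 \<le> 20"
      show "text_inv (butlast w) s' \<and> (reg s' 0 \<noteq> 0 \<longleftrightarrow> reg s' rBad = 0) \<and>
        t1 + (t2 + (t3 + (t4 + 1))) + total_potential B s'
          \<le> total_potential B s + ((108 + 2 * rate) * B + 40)"
      proof (cases "bad = 0")
        case True
        have p: "processed s' = i" "processed s = length w"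
          using c True s1(5) s'(2) awake by (auto simp: processed_def)
        have "text_inv (butlast w) s'"
          using c True s1(5) s' letters p awake unfolding text_inv_def by (auto simp: i_def)
        moreover have "t4 + total_potential B s' \<le> total_potential B s + (108 + 2 * rate) * B + 20"
          using c True s1(2,5) unfolding total_potential_def p by simp
        ultimately show ?thesis
          using s1(6) s'(3) by linarith
      next
        case False
        then have bad: "bad = reg s rBad" "\<not> i < bad" "reg s rBad \<noteq> 0"
          unfolding bad_def by (auto split: if_splits)
        from False c s1 bad have c: "mem s' = mem s" "reg s' rBad = reg s rBad" "t4 \<le> 20"
          by auto
        have p: "processed s' = reg s rBad" "processed s = reg s rBad"
          using bad c(2) by (auto simp: processed_def)
        have "text_inv (butlast w) s'"
          using inv c s' letters p bad unfolding text_inv_def f_def by (auto simp: i_def)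
        moreover have "total_potential B s' = total_potential B s"
          unfolding total_potential_def p c(1) ..
        ultimately show ?thesis
          using s1(6) s'(3) c(3) by linarith
      qed
    qed
  qed
qed

section \<open>Whole sequences of operations\<close>

text \<open>The induction needs an arbitrary current text \<open>w\<close>, and the potential on
  both sides makes the amortized bounds of the single operations telescope.\<close>

lemma run_detector:
  fixes s :: "'a state"
  assumes "text_inv w s"
    and B: "\<And>q. size_of (3 * b) q \<le> M + 1 \<Longrightarrow> q < B"
    and e: "e = 1 + of_nat a / of_nat b"
    and "\<And>i. i < length ops \<Longrightarrow> ops ! i = Backtrack \<Longrightarrow> fold update_text (take i ops) w \<noteq> []"
    and "\<And>i. i \<le> length ops \<Longrightarrow> length (fold update_text (take i ops) w) \<le> M"
  shows "\<exists>answers t s'. run S W (detector a b) s ops answers t s' \<and> length answers = length ops \<and>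
    (\<forall>i<length ops. answers ! i \<longleftrightarrow> repetition_free e (fold update_text (take (Suc i) ops) w)) \<and>
    t + total_potential B s' \<le> total_potential B s + ((108 + 2 * rate) * B + 40) * length ops"
  using assms(1,4,5)
proof (induction ops arbitrary: w s)
  case Nil
  then show ?case
    by (auto intro!: exI run.Nil)
next
  case (Cons op ops)
  let ?w = "update_text op w"
  have len: "length w \<le> M" "length ?w \<le> M"
    using Cons.prems(3)[of 0] Cons.prems(3)[of 1] by simp_all
  have "wp S W (handler (detector a b) op) (\<lambda>t s'. text_inv ?w s' \<and>
     (reg s' 0 \<noteq> 0 \<longleftrightarrow> reg s' rBad = 0) \<and>
     t + total_potential B s' \<le> total_potential B s + ((108 + 2 * rate) * B + 40)) (feed op s)"
  proof (cases op)
    case (Read x)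
    then show ?thesis
      using read_wp[OF Cons.prems(1) _ B, of x] len by simp
  next
    case Backtrack
    then show ?thesis
      using backtrack_wp[OF Cons.prems(1) len(1) _ B] Cons.prems(2)[of 0] by simp
  qed
  then obtain t1 s1 where s1: "exec S W (handler (detector a b) op) (feed op s) t1 s1"
      "text_inv ?w s1" "reg s1 0 \<noteq> 0 \<longleftrightarrow> reg s1 rBad = 0"
      "t1 + total_potential B s1 \<le> total_potential B s + ((108 + 2 * rate) * B + 40)"
    unfolding wp_def by (elim exE conjE) (rule that; assumption)
  have "\<exists>answers t s'. run S W (detector a b) s1 ops answers t s' \<and> length answers = length ops \<and>
    (\<forall>i<length ops. answers ! i \<longleftrightarrow> repetition_free e (fold update_text (take (Suc i) ops) ?w)) \<and>
    t + total_potential B s' \<le> total_potential B s1 + ((108 + 2 * rate) * B + 40) * length ops"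
    using Cons.IH[OF s1(2)] Cons.prems(2)[of "Suc _"] Cons.prems(3)[of "Suc _"] by simp
  then obtain answers t2 s2 where s2: "run S W (detector a b) s1 ops answers t2 s2"
      "length answers = length ops"
      "\<forall>i<length ops. answers ! i \<longleftrightarrow> repetition_free e (fold update_text (take (Suc i) ops) ?w)"
      "t2 + total_potential B s2 \<le> total_potential B s1 + ((108 + 2 * rate) * B + 40) * length ops"
    by blast
  have first: "reg s1 0 \<noteq> 0 \<longleftrightarrow> repetition_free e ?w"
    using s1(3) text_inv_free[OF s1(2)] repetition_free_iff[OF a b e, of ?w] by simp
  show ?case
  proof (intro exI conjI)
    show "run S W (detector a b) s (op # ops) ((reg s1 0 \<noteq> 0) # answers) (t1 + t2) s2"
      using s1(1) s2(1) by (rule run.Cons)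
    show "\<forall>i<length (op # ops). ((reg s1 0 \<noteq> 0) # answers) ! i \<longleftrightarrow>
        repetition_free e (fold update_text (take (Suc i) (op # ops)) w)"
      using first s2(3) by (auto simp: nth_Cons split: nat.split)
    show "t1 + t2 + total_potential B s2
        \<le> total_potential B s + ((108 + 2 * rate) * B + 40) * length (op # ops)"
      using s1(4) s2(4) by simp
  qed (use s2(2) in simp)
qed

lemma text_inv_initial: "text_inv [] (initial_state L A)"
proof -
  have "free_upto a b A 0"
    unfolding free_upto_def using a by auto
  moreover have "slot_inv a b A 0 (\<lambda>_. 0) q" for q
  proof -
    have "2 \<le> 3 * b" using b by simp
    from item_bounds(1,2)[OF this, of q] show ?thesis
      unfolding slot_inv_def by (intro item_inv_initial) auto
  qed
  ultimately show ?thesis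
    by (simp add: text_inv_def processed_def initial_state_def)
qed

lemma total_potential_initial: "total_potential B (initial_state L A) = 0"
  by (simp add: total_potential_def processed_def initial_state_def potential_def)

end

section \<open>Choice of the constants\<close>

lemma rat_gt_one:
  fixes e :: rat
  assumes "e > 1"
  obtains a b :: nat where "1 \<le> a" "1 \<le> b" "e = 1 + of_nat a / of_nat b"
proof -
  obtain x y where xy: "quotient_of e = (x, y)" by fastforce
  then have y: "y > 0" and e: "e = of_int x / of_int y"
    using quotient_of_denom_pos quotient_of_div by blast+
  have "x > y"
    using assms y unfolding e by (simp add: field_simps)
  then have "e = 1 + of_nat (nat (x - y)) / of_nat (nat y)"
    using y unfolding e by (simp add: field_simps)
  moreover have "1 \<le> nat (x - y)" "1 \<le> nat y"
    using \<open>x > y\<close> y by auto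
  ultimately show thesis
    by (rule that[rotated 2])
qed

text \<open>As \<open>m + 1 \<ge> 2\<close> and \<open>c < 2 ^ c\<close>, a constant factor is
  absorbed by enlarging the exponent. This turns the linear bounds on numbers into the required
  bound polynomial in \<open>m\<close>.\<close>

lemma le_power_of_Suc:
  fixes m :: nat
  assumes "1 \<le> m" "x \<le> c * (m + 1)" "c < C"
  shows "x < (m + 1) ^ C"
proof -
  obtain d where C: "C = Suc (c + d)"
    using assms(3) less_iff_Suc_add by auto
  have "c < 2 ^ c" by (rule less_exp)
  also have "(2::nat) ^ c \<le> 2 ^ (c + d)" by (intro power_increasing) auto
  also have "(2::nat) ^ (c + d) \<le> (m + 1) ^ (c + d)"
    using assms(1) by (intro power_mono) auto
  finally have "c * (m + 1) < (m + 1) ^ (c + d) * (m + 1)"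
    by (intro mult_strict_right_mono) auto
  then show ?thesis
    using assms(2) C by (simp add: mult.commute)
qed

theorem theorem1:
  fixes e :: rat
  assumes "e > 1"
  shows "\<exists>(alg :: prog \<times> prog) (C :: nat). \<forall>(ops :: 'a operation list) L A.
    valid_ops ops \<longrightarrow>
    (let n = length ops; m = max_length ops in
      \<exists>answers t s.
        run (C * m) ((m + 1) ^ C) alg (initial_state L A) ops answers t s \<and>
        detects_repetitions e ops answers \<and>
        real t \<le> real C * real n * log 2 (real (m + 1)))"
proof -
  from rat_gt_one[OF assms] obtain a b :: nat
    where ab: "1 \<le> a" "1 \<le> b" and e: "e = 1 + of_nat a / of_nat b" by metis
  \<comment> \<open>This is the amortized cost of an operation per unit of
    \<open>log 2 (m + 1)\<close>: the allowance of one item times \<open>12 * b\<close>, which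
    bounds the number of visited items per unit, plus the fixed 40.\<close>
  define c where "c = (108 + 2 * (480 * a * b + 14)) * (12 * b) + 40"
  \<comment> \<open>One constant has three tasks: it bounds the time factor \<open>c\<close>,
    exceeds the factors \<open>2 * a\<close> and \<open>48 * b + 10\<close> required for numbers,
    and is at least the factor \<open>36 * b\<close> required for memory.\<close>
  define C where "C = c + (2 * a + 48 * b + 11)"
  have main: "\<exists>answers t s.
        run (C * m) ((m + 1) ^ C) (detector a b) (initial_state L A) ops answers t s \<and>
        detects_repetitions e ops answers \<and>
        real t \<le> real C * real n * log 2 (real (m + 1))"
    if valid: "valid_ops ops" and nm: "n = length ops" "m = max_length ops"
    for ops :: "'a operation list" and L A n m
  proof (cases "ops = []")
    case True
    then show ?thesis
      using nm by (auto intro!: exI run.Nil simp: detects_repetitions_def)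
  next
    case False
    have len: "length (text_after (take i ops)) \<le> m" if "i \<le> length ops" for i
      unfolding nm max_length_def using that by (intro Max_ge) auto
    \<comment> \<open>A nonempty valid sequence starts with a read. Thus the logarithm is at least 1
      and absorbs additive constants, and \<open>C * m\<close> leaves room for memory.\<close>
    have m: "1 \<le> m"
    proof -
      have "ops ! 0 \<noteq> Backtrack"
        using valid False unfolding valid_ops_def text_after_def by force
      then obtain x where "ops ! 0 = Read x"
        by (cases "ops ! 0") auto
      then have "length (text_after (take 1 ops)) = 1"
        using False by (cases ops) (auto simp: text_after_def)
      then show ?thesis
        using len[of 1] False by (cases ops) auto
    qed
    define l where "l = log 2 (real (m + 1))"
    have l: "1 \<le> l"
      unfolding l_def using m by simp
    \<comment> \<open>A visited item \<open>q\<close> satisfies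
      \<open>2 ^ (q div (3 * b)) \<le> 2 * (m + 1)\<close>, so the quotient is at most
      \<open>1 + l\<close>; rounding \<open>l\<close> down and passing to a strict bound gives the
      2.\<close>
    define B where "B = 3 * b * (nat \<lfloor>l\<rfloor> + 2)"
    interpret resources a b m "C * m" "(m + 1) ^ C"
    proof
      have "a * (m + 2) \<le> a * (2 * (m + 1))"
        by (intro mult_le_mono2) simp
      then show "a * (m + 2) < (m + 1) ^ C"
        using m by (intro le_power_of_Suc[where c = "2 * a"]) (auto simp: C_def)
      have "24 * b * (m + 2) + 10 \<le> (48 * b + 10) * (m + 1)"
        by (simp add: algebra_simps)
      then show "24 * b * (m + 2) + 10 < (m + 1) ^ C"
        using m by (intro le_power_of_Suc[where c = "48 * b + 10"]) (auto simp: C_def)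
      have "12 * b * (m + 2) \<le> 12 * b * (3 * m)"
        using m by (intro mult_le_mono2) simp
      also have "\<dots> = 36 * b * m"
        by simp
      also have "\<dots> \<le> C * m"
        by (intro mult_le_mono1) (simp add: C_def)
      finally show "12 * b * (m + 2) \<le> C * m" .
    qed (rule ab)+
    have B: "q < B" if "size_of (3 * b) q \<le> m + 1" for q
    proof -
      have "2 \<le> 3 * b"
        using ab by simp
      from item_count(2)[OF this that] have "2 ^ (q div (3 * b)) \<le> 2 * (m + 1)" .
      then have "real (2 ^ (q div (3 * b))) \<le> real (2 * (m + 1))"
        by (simp only: of_nat_le_iff)
      then have "log 2 (2 ^ (q div (3 * b))) \<le> log 2 (2 * real (m + 1))"
        by (subst log_le_cancel_iff) auto
      also have "\<dots> = 1 + l"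
        unfolding l_def by (subst log_mult) auto
      finally have "real (q div (3 * b)) \<le> 1 + l"
        by simp
      then have "int (q div (3 * b)) \<le> 1 + \<lfloor>l\<rfloor>"
        by linarith
      then have "q div (3 * b) < nat \<lfloor>l\<rfloor> + 2"
        by linarith
      then show ?thesis
        unfolding B_def using ab by (simp add: div_less_iff_less_mult mult.commute)
    qed
    have "\<exists>answers t s'. run (C * m) ((m + 1) ^ C) (detector a b) (initial_state L A) ops answers t s' \<and>
      length answers = length ops \<and>
      (\<forall>i<length ops. answers ! i \<longleftrightarrow> repetition_free e (fold update_text (take (Suc i) ops) [])) \<and>
      t + total_potential B s' \<le> total_potential B (initial_state L A)
        + ((108 + 2 * rate) * B + 40) * length ops"
      by (rule run_detector[OF text_inv_initial _ e])
        (use B valid len in \<open>auto simp: valid_ops_def text_after_def\<close>)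
    then obtain answers t s' where run:
        "run (C * m) ((m + 1) ^ C) (detector a b) (initial_state L A) ops answers t s'"
        "length answers = length ops"
        "\<forall>i<length ops. answers ! i \<longleftrightarrow> repetition_free e (text_after (take (Suc i) ops))"
        "t \<le> ((108 + 2 * rate) * B + 40) * n"
      unfolding total_potential_initial text_after_def nm by auto
    have "real B \<le> 3 * real b * (l + 2)"
    proof -
      have "real (nat \<lfloor>l\<rfloor>) \<le> l"
        using l by linarith
      then have "3 * real b * (real (nat \<lfloor>l\<rfloor>) + 2) \<le> 3 * real b * (l + 2)"
        by (intro mult_left_mono) auto
      moreover have "real B = 3 * real b * (real (nat \<lfloor>l\<rfloor>) + 2)"
        unfolding B_def by (simp only: of_nat_mult of_nat_add of_nat_numeral)
      ultimately show ?thesis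
        by linarith
    qed
    also have "\<dots> \<le> 3 * real b * (4 * l)"
      using l by (intro mult_left_mono) auto
    finally have Bl: "real B \<le> real (12 * b) * l"
      by simp
    have "real ((108 + 2 * rate) * B + 40) = real (108 + 2 * rate) * real B + 40"
      by simp
    also have "\<dots> \<le> real (108 + 2 * rate) * (real (12 * b) * l) + 40 * l"
      using l Bl by (intro add_mono mult_left_mono) auto
    also have "\<dots> = real c * l"
      unfolding c_def rate_def by (simp add: algebra_simps)
    also have "\<dots> \<le> real C * l"
      using l by (intro mult_right_mono) (auto simp: C_def)
    finally have "real ((108 + 2 * rate) * B + 40) * real n \<le> real C * l * real n"
      by (intro mult_right_mono) auto
    moreover have "real t \<le> real ((108 + 2 * rate) * B + 40) * real n"
      using run(4) by (metis of_nat_le_iff of_nat_mult)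
    ultimately have "real t \<le> real C * real n * l"
      by (simp add: mult_ac)
    then show ?thesis
      using run unfolding detects_repetitions_def l_def by blast
  qed
  show ?thesis
    unfolding Let_def using main by blast
qed

end
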